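(* Let $\Phi:\mathcal A^{\mathbb Z}\to\mathcal A^{\mathbb Z}$ be any cellular automaton. The following are equivalent: (a) $\Phi$ is surjective onto $\mathcal A^{\mathbb Z}$. (b) $\Phi_\varsigma(\mathcal M)$ is $d_\triangle$-dense in $\mathcal M$, and $\Phi_\varsigma(\mathcal O)$ is $d_\triangle$-dense in $\mathcal O$. (c) $\Phi(\mathcal{QS}_\varsigma)$ is $d_B$-dense in $\mathcal{QS}_\varsigma$. (d) $\Phi(\mathcal{QS}_\varsigma)$ is $d_C$-dense in $\mathcal{QS}_\varsigma$.
   Context: Fix an integer $K\ge1$, $\mathbf{T}=(\mathbb{R}/\mathbb{Z})^K$ with Lebesgue (Haar) probability measure $\lambda$, and an element $\alpha\in\mathbf T$ such that $z\mapsto z\alpha$ is an injective homomorphism $\mathbb Z\to\mathbf T$ with dense image. For $z\in\mathbb{Z}$ let $\varsigma^z(t)=t+z\alpha$. Let $\mathcal{A}$ be a finite set. A cellular automaton is a map $\Phi:\mathcal{A}^{\mathbb{Z}}\to\mathcal{A}^{\mathbb{Z}}$ given by a finite $B\subset\mathbb{Z}$ and a local map $\phi:\mathcal{A}^B\to\mathcal{A}$ via $\Phi(\mathbf a)_\ell=\phi([a_{\ell+b}]_{b\in B})$. $\mathcal M$ is the set of $\mathcal A$-labelled measurable partitions of $\mathbf T$: families $\mathcal P=\{P_a\}_{a\in\mathcal A}$ of disjoint measurable sets such that $P_*:=\bigsqcup_aP_a$ has $\lambda(P_* )=1$, with metric $d_\triangle(\mathcal P,\mathcal Q)=\sum_{a}\lambda(P_a\triangle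 Q_a)$ (partitions at distance $0$ are identified). $\mathcal O\subset\mathcal M$ is the set of open partitions: all $P_a$ open and $P_*$ dense. The induced map $\Phi_\varsigma:\mathcal M\to\mathcal M$ is $\Phi_\varsigma(\mathcal P)=\{Q_a\}_a$ with $Q_a=\bigcup_{\mathbf c\in\mathcal A^B,\ \phi(\mathbf c)=a}\bigcap_{b\in B}\varsigma^{-b}(P_{c_b})$; it maps $\mathcal O$ into $\mathcal O$. For $\mathcal P\in\mathcal O$ let $\widetilde{\mathbf T}(\mathcal P)=\bigcap_{z\in\mathbb Z}\varsigma^z(P_* )$ and for $t\in\widetilde{\mathbf T}(\mathcal P)$ let $\mathcal P_\varsigma(t)\in\mathcal A^{\mathbb Z}$ have $z$-th entry the unique $a$ with $\varsigma^z(t)\in P_a$. $\mathcal{QS}_\varsigma=\{\mathcal P_\varsigma(t):\mathcal P\in\mathcal O,\ t\in\widetilde{\mathbf T}(\mathcal P)\}$. $d_C(\mathbf p,\mathbf q)=2^{-\min\{|z|:\,p_z\ne q_z\}}$ is the Cantor metric (inducing the product topology), and $d_B(\mathbf p,\mathbf q)=\limsup_{N\to\infty}\frac{1}{2N}\#\{z\in[-N,N)\cap\mathbb Z: p_z\ne q_z\}$ is the Besicovitch pseudometric. *)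

theory Defs
  imports "HOL-Probability.Probability"
begin

section \<open>The torus\<close>

quotient_type (overloaded) 'k torus = "real ^ 'k::finite" /
  "\<lambda>x y. \<forall>i. x $ i - y $ i \<in> \<int>"
proof (rule equivpI)
  show "reflp (\<lambda>x y::real^'k. \<forall>i. x $ i - y $ i \<in> \<int>)"
    by (auto intro: reflpI)
  show "symp (\<lambda>x y::real^'k. \<forall>i. x $ i - y $ i \<in> \<int>)"
    by (rule sympI) (metis minus_in_Ints_iff minus_diff_eq)
  show "transp (\<lambda>x y::real^'k. \<forall>i. x $ i - y $ i \<in> \<int>)"
  proof (rule transpI, intro allI)
    fix x y z :: "real^'k" and i
    assume "\<forall>i. x $ i - y $ i \<in> \<int>" "\<forall>i. y $ i - z $ i \<in> \<int>"
    then have "(x $ i - y $ i) + (y $ i - z $ i) \<in> \<int>" by (blast intro: Ints_add)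
    then show "x $ i - z $ i \<in> \<int>" by simp
  qed
qed

instantiation torus :: (finite) ab_group_add
begin

lift_definition zero_torus :: "'a torus" is "0" .

lift_definition plus_torus :: "'a torus \<Rightarrow> 'a torus \<Rightarrow> 'a torus" is "(+)"
  by (metis (no_types, opaque_lifting) Ints_add add_diff_add vector_add_component)

lift_definition uminus_torus :: "'a torus \<Rightarrow> 'a torus" is "uminus"
  by (metis (no_types, opaque_lifting) minus_diff_minus minus_in_Ints_iff vector_uminus_component)

lift_definition minus_torus :: "'a torus \<Rightarrow> 'a torus \<Rightarrow> 'a torus" is "(-)"
proof -
  fix x1 x2 y1 y2 :: "real^'a" and i
  assume "\<And>i. x1 $ i - x2 $ i \<in> \<int>" "\<And>i. y1 $ i - y2 $ i \<in> \<int>"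
  then have "(x1 $ i - x2 $ i) - (y1 $ i - y2 $ i) \<in> \<int>" by (blast intro: Ints_diff)
  then show "(x1 - y1) $ i - (x2 - y2) $ i \<in> \<int>" by (simp add: algebra_simps)
qed

instance by standard (transfer, simp add: algebra_simps)+

end

lift_definition torus_zmult :: "int \<Rightarrow> 'k torus \<Rightarrow> 'k::finite torus"
  is "\<lambda>z x. of_int z *\<^sub>R x"
proof -
  fix z :: int and x y :: "real^'k" and i
  assume "\<And>i. x $ i - y $ i \<in> \<int>"
  then have "of_int z * (x $ i - y $ i) \<in> \<int>" by (blast intro: Ints_mult Ints_of_int)
  then show "(of_int z *\<^sub>R x) $ i - (of_int z *\<^sub>R y) $ i \<in> \<int>"
    by (simp add: algebra_simps)
qed

lemma torus_zmult_add: "torus_zmult (m + n) t = torus_zmult m t + torus_zmult n t"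
  by transfer (simp add: algebra_simps)

lemma torus_zmult_1: "torus_zmult 1 t = t"
  by transfer simp

instantiation torus :: (finite) topological_space
begin

definition open_torus :: "'a torus set \<Rightarrow> bool"
  where "open_torus U \<longleftrightarrow> open (abs_torus -` U)"

instance
proof
  show "open (UNIV :: 'a torus set)" by (simp add: open_torus_def)
  show "open (S \<inter> T)" if "open S" "open T" for S T :: "'a torus set"
    using that by (simp add: open_torus_def vimage_Int open_Int)
  show "open (\<Union>K)" if "\<forall>S\<in>K. open S" for K :: "'a torus set set"
    using that by (auto simp: open_torus_def vimage_Union intro!: open_UN)
qed

end

lemma continuous_abs_torus: "continuous_on UNIV (abs_torus :: real^'k \<Rightarrow> 'k::finite torus)"
  by (simp add: continuous_on_open_vimage open_torus_def)

definition unit_cube :: "(real ^ 'k::finite) set"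
  where "unit_cube = {x. \<forall>i. 0 \<le> x $ i \<and> x $ i < 1}"

text \<open>The completion makes the measurable sets the Lebesgue measurable ones, rather than
  only the Borel sets.\<close>

definition torus_measure :: "'k::finite torus measure"
  where "torus_measure = completion (distr (restrict_space lborel unit_cube) borel abs_torus)"

lemma prob_space_torus_measure: "prob_space (torus_measure :: 'k::finite torus measure)"
proof -
  have sub: "box 0 1 \<subseteq> (unit_cube :: (real^'k) set)" "unit_cube \<subseteq> cbox 0 (1 :: real^'k)"
    by (auto simp: unit_cube_def mem_box_cart less_imp_le)
  have m: "(unit_cube :: (real^'k) set) \<in> sets borel"
    unfolding unit_cube_def by measurable
  have one: "emeasure lborel (box 0 (1::real^'k)) = 1" "emeasure lborel (cbox 0 (1::real^'k)) = 1"
    by (auto simp: emeasure_lborel_box_eq emeasure_lborel_cbox_eq Basis_vec_def inner_axis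
        prod.neutral)
  have "emeasure lborel (unit_cube :: (real^'k) set) = 1"
    using emeasure_mono[OF sub(1), of lborel] emeasure_mono[OF sub(2), of lborel] one m
    by (intro antisym) auto
  then have p: "prob_space (restrict_space lborel (unit_cube :: (real^'k) set))"
    using m by (intro prob_spaceI) (simp add: emeasure_restrict_space space_restrict_space)
  have "abs_torus \<in> borel_measurable (restrict_space lborel (unit_cube :: (real^'k) set))"
    using borel_measurable_continuous_onI[OF continuous_abs_torus]
    by (intro measurable_restrict_space1) simp
  from prob_space.prob_space_distr[OF p this]
  show ?thesis unfolding torus_measure_def by (rule prob_space.prob_space_completion)
qed

definition rotation :: "'k::finite torus \<Rightarrow> int \<Rightarrow> 'k torus \<Rightarrow> 'k torus"
  where "rotation \<alpha> z t = t + torus_zmult z \<alpha>"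


section \<open>Cellular automata\<close>

text \<open>A local map is only ever evaluated on the extensional functions
  \<open>B \<rightarrow>\<^sub>E UNIV\<close>, which represent the configurations on the neighbourhood \<open>B\<close>.\<close>

definition cellular_automaton ::
    "int set \<Rightarrow> ((int \<Rightarrow> 'a) \<Rightarrow> 'a) \<Rightarrow> (int \<Rightarrow> 'a) \<Rightarrow> (int \<Rightarrow> 'a)"
  where "cellular_automaton B \<phi> p = (\<lambda>l. \<phi> (\<lambda>b\<in>B. p (l + b)))"


section \<open>Labelled partitions\<close>

text \<open>Partitions are not quotiented by the relation of being at distance \<open>0\<close>, so
  \<open>partition_dist\<close> is a pseudometric; density is the same for either reading.\<close>

definition measurable_partitions :: "('a::finite \<Rightarrow> 'k::finite torus set) set"
  where "measurable_partitions =
    {P. disjoint_family P \<and> (\<forall>a. P a \<in> sets torus_measure) \<and>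
        measure torus_measure (\<Union>a. P a) = 1}"

definition open_partitions :: "('a::finite \<Rightarrow> 'k::finite torus set) set"
  where "open_partitions =
    {P \<in> measurable_partitions. (\<forall>a. open (P a)) \<and> closure (\<Union>a. P a) = UNIV}"

definition partition_dist ::
    "('a::finite \<Rightarrow> 'k::finite torus set) \<Rightarrow> ('a \<Rightarrow> 'k torus set) \<Rightarrow> real"
  where "partition_dist P Q = (\<Sum>a\<in>UNIV. measure torus_measure (sym_diff (P a) (Q a)))"

definition induced_map :: "'k::finite torus \<Rightarrow> int set \<Rightarrow> ((int \<Rightarrow> 'a::finite) \<Rightarrow> 'a) \<Rightarrow>
    ('a \<Rightarrow> 'k torus set) \<Rightarrow> ('a \<Rightarrow> 'k torus set)"
  where "induced_map \<alpha> B \<phi> P =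
    (\<lambda>a. \<Union>c\<in>{c \<in> B \<rightarrow>\<^sub>E UNIV. \<phi> c = a}. \<Inter>b\<in>B. rotation \<alpha> (- b) ` P (c b))"


section \<open>Quasisturmian sequences\<close>

definition coding_domain ::
    "'k::finite torus \<Rightarrow> ('a::finite \<Rightarrow> 'k torus set) \<Rightarrow> 'k torus set"
  where "coding_domain \<alpha> P = (\<Inter>z. rotation \<alpha> z ` (\<Union>a. P a))"

definition coding ::
    "'k::finite torus \<Rightarrow> ('a::finite \<Rightarrow> 'k torus set) \<Rightarrow> 'k torus \<Rightarrow> int \<Rightarrow> 'a"
  where "coding \<alpha> P t = (\<lambda>z. THE a. rotation \<alpha> z t \<in> P a)"

definition quasisturmian :: "'k::finite torus \<Rightarrow> (int \<Rightarrow> 'a::finite) set"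
  where "quasisturmian \<alpha> = {coding \<alpha> P t | P t. P \<in> open_partitions \<and> t \<in> coding_domain \<alpha> P}"


section \<open>Metrics on sequences and density\<close>

definition cantor_dist :: "(int \<Rightarrow> 'a) \<Rightarrow> (int \<Rightarrow> 'a) \<Rightarrow> real"
  where "cantor_dist p q =
    (if p = q then 0 else (1 / 2) ^ (LEAST n. \<exists>z. p z \<noteq> q z \<and> n = nat \<bar>z\<bar>))"

text \<open>The sequence lies in \<open>[0, 1]\<close>, so its limit superior in \<open>ereal\<close> is finite.\<close>

definition besicovitch_dist :: "(int \<Rightarrow> 'a) \<Rightarrow> (int \<Rightarrow> 'a) \<Rightarrow> real"
  where "besicovitch_dist p q = real_of_ereal (limsup (\<lambda>N.
    ereal (real (card {z \<in> {- int N..<int N}. p z \<noteq> q z}) / (2 * real N))))"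

definition dense_in :: "('x \<Rightarrow> 'x \<Rightarrow> real) \<Rightarrow> 'x set \<Rightarrow> 'x set \<Rightarrow> bool"
  where "dense_in d S X \<longleftrightarrow> S \<subseteq> X \<and> (\<forall>x\<in>X. \<forall>\<epsilon>>0. \<exists>s\<in>S. d x s < \<epsilon>)"

end

theory Submission
  imports Defs
begin

text \<open>
  A surjective automaton has approximate right inverses on partitions. Fix a small ball around \<open>0\<close>
  in the torus. Since the rotation is minimal and the torus is compact, every orbit visits the ball with
  bounded gaps (\<open>visits_syndetic\<close>), and since \<open>\<alpha>\<close> has infinite order, the gaps can be made at least
  \<open>n\<close> by shrinking the ball (\<open>separated_visits\<close>). Consecutive visits cut the coding of an orbit into
  words. Replace each word by the corresponding segment of a preimage, chosen once for each word. The
  new labels depend only on the word and on the position in it, so they come from a partition of the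
  torus, which is open if the old one is. Applying the automaton gives back the old labels except near
  the ends of the words, that is, on a set of times of density of order \<open>1 / n\<close> and on a set of points
  of measure of order \<open>1 / n\<close> (\<open>approximate_preimage\<close>). This yields density of the images for
  partitions and for the Besicovitch pseudometric. The radius of the ball is chosen such that its
  boundary sphere is negligible and misses the orbit under consideration (\<open>ex_generic_radius\<close>).

  If the automaton is not surjective, compactness of the full shift gives an orphan word, one that
  occurs in no image (\<open>orphan_word\<close>). There is an open partition for which all points of some nonempty
  open set spell this word (\<open>open_partition_prescribed_word\<close>). This set has positive measure, and each
  orbit visits it with bounded gaps, so the partition and its codings stay at a positive distance
  from all images. The Cantor metric needs less: quasisturmian sequences are dense in the full shift,
  whose image under the automaton is closed.

  Positivity of the measure of open sets follows from minimality and from translation invariance of the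
  measure. The invariance is proved by cutting a translated unit cube along the integer lattice
  (\<open>emeasure_periodic_translated_cube\<close>).
\<close>

section \<open>The torus as a compact topological group\<close>

lemma abs_torus_eq_iff: "abs_torus x = abs_torus y \<longleftrightarrow> (\<forall>i. x $ i - y $ i \<in> \<int>)"
  using torus.abs_eq_iff by blast

lemma abs_torus_plus: "abs_torus x + abs_torus y = abs_torus (x + y)"
  by (rule plus_torus.abs_eq)

lemma abs_torus_surj: "\<exists>x. t = abs_torus x"
  using Quotient3_abs_rep[OF Quotient3_torus, of t] by metis

lemma open_vimage_translation:
  fixes U :: "'k::finite torus set"
  assumes "open U" shows "open ((\<lambda>t. t + s) -` U)"
proof -
  obtain v where v: "s = abs_torus v" using abs_torus_surj by blast
  have "open ((\<lambda>x. x + v) -` (abs_torus -` U))"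
    using assms unfolding open_torus_def by (rule open_vimage) (intro continuous_intros)
  moreover have "(\<lambda>x. x + v) -` (abs_torus -` U) = abs_torus -` ((\<lambda>t. t + s) -` U)"
    by (auto simp: v abs_torus_plus)
  ultimately show ?thesis by (simp add: open_torus_def)
qed

lemma compact_UNIV_torus: "compact (UNIV :: 'k::finite torus set)"
proof -
  have "t \<in> abs_torus ` cbox 0 1" for t :: "'k torus"
  proof -
    obtain x where x: "t = abs_torus x" using abs_torus_surj by blast
    have "t = abs_torus (\<chi> i. frac (x $ i))"
      unfolding x abs_torus_eq_iff by (simp add: frac_def)
    moreover have "(\<chi> i. frac (x $ i)) \<in> cbox 0 (1 :: real^'k)"
      by (simp add: mem_box_cart frac_lt_1 less_imp_le)
    ultimately show ?thesis by blast
  qed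
  then have "UNIV = abs_torus ` cbox 0 (1 :: real^'k)" by auto
  then show ?thesis
    by (metis compact_cbox compact_continuous_image continuous_abs_torus continuous_on_subset top_greatest)
qed

section \<open>Translation invariance of Lebesgue measure on the torus\<close>

text \<open>The lattice that is divided out, indexed by a countable type so that sums over the lattice are
  countable sums.\<close>

definition integer_vector :: "int^'k \<Rightarrow> real^'k::finite"
  where "integer_vector z = (\<chi> i. of_int (z $ i))"

lemma abs_torus_integer_vector: "abs_torus (x + integer_vector z) = abs_torus x"
  unfolding abs_torus_eq_iff by (simp add: integer_vector_def)

lemma ex1_unit_cube_representative: "\<exists>!z. x - integer_vector z \<in> unit_cube"
proof (rule ex1I)
  show "x - integer_vector (\<chi> i. \<lfloor>x $ i\<rfloor>) \<in> unit_cube"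
    by (simp add: unit_cube_def integer_vector_def) linarith
next
  fix z assume z: "x - integer_vector z \<in> unit_cube"
  have "z $ i = \<lfloor>x $ i\<rfloor>" for i
    using z[unfolded unit_cube_def integer_vector_def, simplified, rule_format, of i] by linarith
  then show "z = (\<chi> i. \<lfloor>x $ i\<rfloor>)" by (simp add: vec_eq_iff)
qed

lemma unit_cube_borel: "unit_cube \<in> sets (borel :: (real^'k::finite) measure)"
  unfolding unit_cube_def by measurable

lemma emeasure_lborel_vimage_translation:
  fixes X :: "'b::euclidean_space set"
  assumes [measurable]: "X \<in> sets borel"
  shows "emeasure lborel ((\<lambda>x. x + v) -` X) = emeasure lborel X"
proof -
  have "emeasure lborel X = emeasure (distr lborel borel ((+) v)) X"
    by (simp add: lborel_distr_plus)
  also have "\<dots> = emeasure lborel ((+) v -` X \<inter> space lborel)"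
    by (rule emeasure_distr) auto
  also have "(+) v -` X \<inter> space lborel = (\<lambda>x. x + v) -` X"
    by (auto simp: add.commute)
  finally show ?thesis by simp
qed

text \<open>Both the unit cube and its translate by \<open>v\<close> are fundamental domains of the lattice. Cutting the
  translate along the tiling by integer translates of the cube and moving each piece back by its
  integer vector, which a periodic set does not notice, reassembles the cube.\<close>

lemma emeasure_periodic_translated_cube:
  fixes S :: "(real^'k::finite) set"
  assumes S[measurable]: "S \<in> sets borel"
    and periodic: "\<And>x z. x + integer_vector z \<in> S \<longleftrightarrow> x \<in> S"
  shows "emeasure lborel ({x. x - v \<in> unit_cube} \<inter> S) = emeasure lborel (unit_cube \<inter> S)"
proof -
  note unit_cube_borel[measurable]
  let ?X = "\<lambda>z. {x. x - v \<in> unit_cube} \<inter> {x. x - integer_vector z \<in> unit_cube} \<inter> S"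
  \<comment> \<open>\<open>?X z\<close> is the piece in the cube at \<open>z\<close>, and \<open>?Y z\<close> is this piece moved back to the unit cube.\<close>
  let ?Y = "\<lambda>z. {x. x + integer_vector z - v \<in> unit_cube} \<inter> unit_cube \<inter> S"
  have mC[measurable]: "{x. x - u \<in> unit_cube} \<in> sets (borel :: (real^'k) measure)" for u
    using measurable_sets[OF _ unit_cube_borel, of "\<lambda>x. x - u" borel]
    by (simp add: vimage_def)
  have mY: "?Y z \<in> sets lborel" for z
    using mC[of "v - integer_vector z"] by (simp add: algebra_simps)
  have XY: "emeasure lborel (?X z) = emeasure lborel (?Y z)" for z
  proof -
    have "(\<lambda>x. x + integer_vector z) -` ?X z = ?Y z" using periodic by auto
    then show ?thesis
      using emeasure_lborel_vimage_translation[of "?X z" "integer_vector z"] by simp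
  qed
  have "{x. x - v \<in> unit_cube} \<inter> S = (\<Union>z. ?X z)"
    using ex1_unit_cube_representative by blast
  moreover have "disjoint_family ?X"
    unfolding disjoint_family_on_def using ex1_unit_cube_representative by blast
  ultimately have X: "emeasure lborel ({x. x - v \<in> unit_cube} \<inter> S)
      = (\<integral>\<^sup>+z. emeasure lborel (?X z) \<partial>count_space UNIV)"
    by (simp only:) (rule emeasure_UN_countable, auto)
  have minus: "x + integer_vector z - v = (x - v) - integer_vector (- z)" for x z
    by (simp add: integer_vector_def vec_eq_iff)
  have "\<exists>z. x + integer_vector z - v \<in> unit_cube" for x
    using ex1_unit_cube_representative[of "x - v"] unfolding minus
    by (metis minus_minus)
  then have "unit_cube \<inter> S = (\<Union>z. ?Y z)" by blast
  moreover have "disjoint_family ?Y"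
    unfolding disjoint_family_on_def minus
    using ex1_unit_cube_representative neg_equal_iff_equal by blast
  ultimately have "emeasure lborel (unit_cube \<inter> S)
      = (\<integral>\<^sup>+z. emeasure lborel (?Y z) \<partial>count_space UNIV)"
    using mY by (simp only:) (rule emeasure_UN_countable, auto)
  with X XY show ?thesis by simp
qed

lemma emeasure_torus_borel:
  fixes A :: "'k::finite torus set"
  assumes [measurable]: "A \<in> sets borel"
  shows "emeasure (distr (restrict_space lborel unit_cube) borel abs_torus) A
    = emeasure lborel (unit_cube \<inter> abs_torus -` A)"
proof -
  have [measurable]: "abs_torus \<in> borel_measurable (borel :: (real^'k) measure)"
    by (rule borel_measurable_continuous_onI[OF continuous_abs_torus])
  have "abs_torus \<in> borel_measurable (restrict_space lborel (unit_cube :: (real^'k) set))"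
    by (intro measurable_restrict_space1) simp
  then show ?thesis
    using unit_cube_borel
    by (subst emeasure_distr)
      (auto simp: space_restrict_space Int_commute intro!: emeasure_restrict_space)
qed

text \<open>On Borel sets this is the lemma on periodic sets. It passes to the completion because a
  translation then pulls Borel null sets back to null sets.\<close>

lemma
  fixes s :: "'k::finite torus"
  shows measurable_torus_translation: "(\<lambda>t. t + s) \<in> torus_measure \<rightarrow>\<^sub>M torus_measure" (is ?m)
    and distr_torus_translation: "distr torus_measure torus_measure (\<lambda>t. t + s) = torus_measure" (is ?d)
proof -
  define M0 where "M0 = distr (restrict_space lborel unit_cube) borel (abs_torus :: _ \<Rightarrow> 'k torus)"
  have sets_M0[simp]: "sets M0 = sets borel" by (simp add: M0_def)
  have tb: "(\<lambda>t. t + s) \<in> borel \<rightarrow>\<^sub>M borel"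
    by (intro borel_measurableI) (simp add: open_vimage_translation borel_open)
  then have t0: "(\<lambda>t. t + s) \<in> M0 \<rightarrow>\<^sub>M M0" unfolding measurable_cong_sets[OF sets_M0 sets_M0] .
  have inv: "distr M0 M0 (\<lambda>t. t + s) = M0"
  proof (rule measure_eqI)
    fix A assume "A \<in> sets (distr M0 M0 (\<lambda>t. t + s))"
    then have A: "A \<in> sets borel" by simp
    obtain v where v: "s = abs_torus v" using abs_torus_surj by blast
    let ?S = "abs_torus -` A"
    have S: "?S \<in> sets borel"
      using measurable_sets[OF borel_measurable_continuous_onI[OF continuous_abs_torus] A] by simp
    have C: "{x. x - v \<in> unit_cube} \<in> sets borel"
      using measurable_sets[OF _ unit_cube_borel, of "\<lambda>x. x - v" borel] by (simp add: vimage_def)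
    have A': "(\<lambda>t. t + s) -` A \<in> sets borel" using measurable_sets[OF tb A] by simp
    have "emeasure (distr M0 M0 (\<lambda>t. t + s)) A = emeasure M0 ((\<lambda>t. t + s) -` A)"
      using A t0 by (subst emeasure_distr) (auto simp: M0_def)
    also have "\<dots> = emeasure lborel (unit_cube \<inter> abs_torus -` ((\<lambda>t. t + s) -` A))"
      unfolding M0_def by (rule emeasure_torus_borel[OF A'])
    also have "unit_cube \<inter> abs_torus -` ((\<lambda>t. t + s) -` A)
        = (\<lambda>x. x + v) -` ({x. x - v \<in> unit_cube} \<inter> ?S)"
      by (auto simp: v abs_torus_plus)
    also have "emeasure lborel \<dots> = emeasure lborel ({x. x - v \<in> unit_cube} \<inter> ?S)"
      using S C by (intro emeasure_lborel_vimage_translation) auto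
    also have "\<dots> = emeasure lborel (unit_cube \<inter> ?S)"
      using S by (intro emeasure_periodic_translated_cube) (auto simp: abs_torus_integer_vector)
    also have "\<dots> = emeasure M0 A" unfolding M0_def by (rule emeasure_torus_borel[OF A, symmetric])
    finally show "emeasure (distr M0 M0 (\<lambda>t. t + s)) A = emeasure M0 A" .
  qed simp
  have tm: "torus_measure = completion M0" by (simp add: torus_measure_def M0_def)
  have tc: "(\<lambda>t. t + s) \<in> completion M0 \<rightarrow>\<^sub>M M0" using t0 by (rule measurable_completion)
  have d: "distr (completion M0) M0 (\<lambda>t. t + s) = M0"
    using distr_completion[OF t0] inv by simp
  show ?m unfolding tm
    by (intro complete_measure.measurable_completion2 completion.complete_measure_axioms tc) (simp add: d)
  show ?d unfolding tm
    using complete_measure.completion_distr_eq[OF completion.complete_measure_axioms tc] by (simp add: d)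
qed

interpretation torus: prob_space "torus_measure :: 'k::finite torus measure"
  by (rule prob_space_torus_measure)

lemma space_torus_measure [simp]: "space torus_measure = UNIV"
  by (simp add: torus_measure_def)

lemma borel_sets_torus: "A \<in> sets borel \<Longrightarrow> A \<in> sets torus_measure"
  by (simp add: torus_measure_def)

lemma open_sets_torus [simp]: "open A \<Longrightarrow> A \<in> sets torus_measure"
  by (simp add: borel_sets_torus)

section \<open>Balls with negligible boundary\<close>

text \<open>The sum of the chord lengths from \<open>1\<close> to the points of the unit circle that represent the
  coordinates. A chord does not change when an
  integer is added to the coordinate, so this is a continuous, subadditive substitute for the distance
  to \<open>0\<close>.\<close>

definition torus_norm :: "'k::finite torus \<Rightarrow> real"
  where "torus_norm t = (\<Sum>i\<in>UNIV. cmod (cis (2 * pi * rep_torus t $ i) - 1))"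

lemma torus_norm_abs: "torus_norm (abs_torus x) = (\<Sum>i\<in>UNIV. cmod (cis (2 * pi * x $ i) - 1))"
proof -
  have "abs_torus (rep_torus (abs_torus x)) = abs_torus x"
    by (rule Quotient3_abs_rep[OF Quotient3_torus])
  then have diff: "rep_torus (abs_torus x) $ i - x $ i \<in> \<int>" for i
    by (simp add: abs_torus_eq_iff)
  have "cis (2 * pi * rep_torus (abs_torus x) $ i) = cis (2 * pi * x $ i)" for i
  proof -
    obtain n where "rep_torus (abs_torus x) $ i = x $ i + of_int n"
      using diff[of i] by (metis Ints_cases add.commute diff_add_cancel)
    then have "cis (2 * pi * rep_torus (abs_torus x) $ i) = cis (2 * pi * x $ i) * cis (2 * pi * of_int n)"
      by (simp add: cis_mult algebra_simps)
    then show ?thesis by (simp add: cis_multiple_2pi)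
  qed
  then show ?thesis by (simp add: torus_norm_def)
qed

lemma torus_norm_zero_iff: "torus_norm t = 0 \<longleftrightarrow> t = 0"
proof -
  obtain x where x: "t = abs_torus x" using abs_torus_surj by blast
  have "cis (2 * pi * r) = 1 \<longleftrightarrow> r \<in> \<int>" for r
  proof
    assume "cis (2 * pi * r) = 1"
    then have "cos (2 * pi * r) = 1" by (simp add: complex_eq_iff)
    then obtain n :: int where "2 * pi * r = n * 2 * pi" by (auto simp: cos_one_2pi_int)
    then show "r \<in> \<int>" by (auto simp: field_simps)
  qed (auto simp: cis_multiple_2pi)
  then have "torus_norm t = 0 \<longleftrightarrow> (\<forall>i. x $ i \<in> \<int>)"
    by (simp add: x torus_norm_abs sum_nonneg_eq_0_iff)
  also have "\<dots> \<longleftrightarrow> t = 0" by (simp add: x zero_torus_def abs_torus_eq_iff)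
  finally show ?thesis .
qed

lemma torus_norm_nonneg: "0 \<le> torus_norm t"
  by (simp add: torus_norm_def sum_nonneg)

lemma torus_norm_diff: "torus_norm (s - t) \<le> torus_norm s + torus_norm t"
proof -
  obtain x y where xy: "s = abs_torus x" "t = abs_torus y" using abs_torus_surj by blast
  have "cmod (cis (2 * pi * (a - b)) - 1) \<le> cmod (cis (2 * pi * a) - 1) + cmod (cis (2 * pi * b) - 1)" for a b
  proof -
    have "cis (2 * pi * (a - b)) - 1 = cis (- (2 * pi * b)) * ((cis (2 * pi * a) - 1) - (cis (2 * pi * b) - 1))"
      by (simp add: algebra_simps cis_mult)
    then have "cmod (cis (2 * pi * (a - b)) - 1) = cmod ((cis (2 * pi * a) - 1) - (cis (2 * pi * b) - 1))"
      by (simp add: norm_mult)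
    then show ?thesis using norm_triangle_ineq4 by metis
  qed
  then show ?thesis
    by (simp add: xy torus_norm_abs minus_torus.abs_eq sum.distrib[symmetric] sum_mono)
qed

lemma continuous_torus_norm: "continuous_on UNIV (torus_norm :: 'k::finite torus \<Rightarrow> real)"
proof -
  have "continuous_on UNIV (\<lambda>x :: real^'k. torus_norm (abs_torus x))"
    unfolding torus_norm_abs by (intro continuous_intros)
  then have "open (abs_torus -` (torus_norm -` U :: 'k torus set))" if "open U" for U
    using that open_vimage[of U "\<lambda>x :: real^'k. torus_norm (abs_torus x)"]
    by (simp add: vimage_def)
  then show ?thesis by (simp add: continuous_on_open_vimage open_torus_def)
qed

lemma open_torus_ball: "open {t. torus_norm t < c}"
  and open_torus_ball_exterior: "open {t. c < torus_norm t}"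
  using open_vimage[OF open_lessThan continuous_torus_norm, of c]
    open_vimage[OF open_greaterThan continuous_torus_norm, of c]
  by (simp_all add: vimage_def)

lemma torus_ball_nonempty: "0 < c \<Longrightarrow> {t :: 'k::finite torus. torus_norm t < c} \<noteq> {}"
  using torus_norm_zero_iff[of "0 :: 'k torus"] by (auto intro!: exI[of _ "0 :: 'k torus"])

lemma measurable_torus_norm [measurable]: "torus_norm \<in> borel_measurable torus_measure"
  unfolding torus_measure_def
  by (intro measurable_completion) (simp add: borel_measurable_continuous_onI continuous_torus_norm)

lemma sets_torus_translation:
  "A \<in> sets torus_measure \<Longrightarrow> {t. t + s \<in> A} \<in> sets torus_measure"
  using measurable_sets[OF measurable_torus_translation[of s], of A] by (simp add: vimage_def)

lemma measure_torus_translation: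
  assumes "A \<in> sets torus_measure"
  shows "measure torus_measure {t. t + s \<in> A} = measure torus_measure A"
proof -
  have "measure torus_measure A = measure (distr torus_measure torus_measure (\<lambda>t. t + s)) A"
    by (simp add: distr_torus_translation)
  also have "\<dots> = measure torus_measure {t. t + s \<in> A}"
    using assms measurable_torus_translation by (subst measure_distr) (auto simp: vimage_def)
  finally show ?thesis by simp
qed

lemma AE_torus_translation:
  assumes "AE t in torus_measure. P t"
  shows "AE t in torus_measure. P (t + s)"
proof -
  obtain N where N: "{t. \<not> P t} \<subseteq> N" "N \<in> null_sets torus_measure"
    using assms by (auto simp: eventually_ae_filter)
  then have "{t. t + s \<in> N} \<in> null_sets torus_measure"
    using sets_torus_translation[of N s] measure_torus_translation[of N s]
    by (auto simp: null_sets_def torus.emeasure_eq_measure)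
  then show ?thesis using N(1) by (intro AE_I') auto
qed

text \<open>The spheres around \<open>0\<close> are pairwise disjoint, so only countably many of them have positive measure
  and only countably many meet a given countable set. A radius outside these exceptions makes the
  boundary of the ball invisible to the measure and to a given orbit.\<close>

lemma ex_generic_radius:
  fixes X :: "'k::finite torus set"
  assumes "0 < \<delta>" "countable X"
  obtains c where "0 < c" "c < \<delta>" "AE t in torus_measure. torus_norm (t :: 'k torus) \<noteq> c"
    "\<And>x. x \<in> X \<Longrightarrow> torus_norm x \<noteq> c"
proof -
  interpret D: prob_space "distr torus_measure borel (torus_norm :: 'k torus \<Rightarrow> real)"
    by (intro torus.prob_space_distr measurable_torus_norm)
  define E where "E = {c. D.prob {c} \<noteq> 0} \<union> torus_norm ` X"
  have "countable E" unfolding E_def using D.countable_support assms(2) by auto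
  then have "\<not> {0<..<\<delta>} \<subseteq> E"
    using uncountable_open_interval[of 0 \<delta>] assms(1) countable_subset by blast
  then obtain c where c: "0 < c" "c < \<delta>" "c \<notin> E"
    by (meson greaterThanLessThan_iff subsetI)
  have S: "{t :: 'k torus. torus_norm t = c} \<in> sets torus_measure"
    using measurable_sets[OF measurable_torus_norm, of "{c}"] by (simp add: vimage_def)
  have "measure torus_measure {t :: 'k torus. torus_norm t = c} = 0"
    using c(3) by (simp add: E_def measure_distr vimage_def)
  then have "AE t in torus_measure. torus_norm (t :: 'k torus) \<noteq> c"
    using S by (intro AE_I[of _ _ "{t. torus_norm t = c}"]) (auto simp: torus.emeasure_eq_measure)
  with c show ?thesis using that[of c] by (auto simp: E_def)
qed

section \<open>Rotations, codings and the induced map\<close>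

lemma torus_zmult_0: "torus_zmult 0 t = 0"
  by transfer simp

lemma rotation_0 [simp]: "rotation \<alpha> 0 t = t"
  by (simp add: rotation_def torus_zmult_0)

lemma rotation_rotation [simp]: "rotation \<alpha> m (rotation \<alpha> n t) = rotation \<alpha> (m + n) t"
  by (simp add: rotation_def torus_zmult_add algebra_simps)

lemma rotation_image: "rotation \<alpha> z ` A = {t. rotation \<alpha> (- z) t \<in> A}"
proof (intro set_eqI iffI)
  fix t assume "t \<in> {t. rotation \<alpha> (- z) t \<in> A}"
  then show "t \<in> rotation \<alpha> z ` A"
    by (intro image_eqI[of _ _ "rotation \<alpha> (- z) t"]) auto
qed auto

lemma open_rotation: "open U \<Longrightarrow> open {t. rotation \<alpha> z t \<in> U}"
  using open_vimage_translation[of U "torus_zmult z \<alpha>"] by (simp add: rotation_def vimage_def)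

lemma sets_rotation: "A \<in> sets torus_measure \<Longrightarrow> {t. rotation \<alpha> z t \<in> A} \<in> sets torus_measure"
  using sets_torus_translation[of A "torus_zmult z \<alpha>"] by (simp add: rotation_def)

lemma measure_rotation:
  "A \<in> sets torus_measure \<Longrightarrow> measure torus_measure {t. rotation \<alpha> z t \<in> A} = measure torus_measure A"
  using measure_torus_translation[of A "torus_zmult z \<alpha>"] by (simp add: rotation_def)

lemma AE_rotation:
  "AE t in torus_measure. Q t \<Longrightarrow> AE t in torus_measure. \<forall>z. Q (rotation \<alpha> z t)"
  by (simp add: AE_all_countable rotation_def AE_torus_translation)

lemma mem_coding_domain: "t \<in> coding_domain \<alpha> P \<longleftrightarrow> (\<forall>z. \<exists>a. rotation \<alpha> z t \<in> P a)"
  unfolding coding_domain_def rotation_image by auto (metis minus_minus)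

lemma coding_eqI:
  assumes "disjoint_family P" "rotation \<alpha> z t \<in> P a" shows "coding \<alpha> P t z = a"
  unfolding coding_def using assms by (intro the_equality) (auto simp: disjoint_family_on_def)

lemma coding_rotation: "coding \<alpha> P (rotation \<alpha> n t) z = coding \<alpha> P t (z + n)"
  by (simp add: coding_def)

lemma rotation_coding_domain: "t \<in> coding_domain \<alpha> P \<Longrightarrow> rotation \<alpha> z t \<in> coding_domain \<alpha> P"
  by (simp add: mem_coding_domain)

lemma measurable_partitions_iff:
  "P \<in> measurable_partitions \<longleftrightarrow> disjoint_family P \<and> (\<forall>a. P a \<in> sets torus_measure) \<and>
     (AE t in torus_measure. \<exists>a. t \<in> P a)"
proof -
  have "measure torus_measure (\<Union>a. P a) = 1 \<longleftrightarrow> (AE t in torus_measure. \<exists>a. t \<in> P a)"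
    if "\<forall>a. P a \<in> sets torus_measure"
    using that torus.prob_eq_1[of "\<Union>a. P a"] by auto
  then show ?thesis by (auto simp: measurable_partitions_def)
qed

lemma AE_coding_domain: "P \<in> measurable_partitions \<Longrightarrow> AE t in torus_measure. t \<in> coding_domain \<alpha> P"
  using AE_rotation[of "\<lambda>t. \<exists>a. t \<in> P a" \<alpha>]
  by (simp add: measurable_partitions_iff mem_coding_domain)

lemma induced_map_iff:
  "t \<in> induced_map \<alpha> B \<phi> P a \<longleftrightarrow>
    (\<exists>c \<in> B \<rightarrow>\<^sub>E UNIV. \<phi> c = a \<and> (\<forall>b\<in>B. rotation \<alpha> b t \<in> P (c b)))"
  unfolding induced_map_def rotation_image by auto

text \<open>On the torus the induced map acts as the cellular automaton does on codings: the label of a point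
  is computed from the labels along its orbit. By disjointness the local pattern is determined.\<close>

lemma induced_map_iff_coding:
  assumes "disjoint_family P"
  shows "t \<in> induced_map \<alpha> B \<phi> P a \<longleftrightarrow>
    (\<forall>b\<in>B. \<exists>a'. rotation \<alpha> b t \<in> P a') \<and> \<phi> (\<lambda>b\<in>B. coding \<alpha> P t b) = a"
proof
  assume "t \<in> induced_map \<alpha> B \<phi> P a"
  then obtain c where c: "c \<in> B \<rightarrow>\<^sub>E UNIV" "\<phi> c = a" "\<forall>b\<in>B. rotation \<alpha> b t \<in> P (c b)"
    unfolding induced_map_iff by blast
  then have "(\<lambda>b\<in>B. coding \<alpha> P t b) = c"
    using coding_eqI[OF assms] by (auto simp: fun_eq_iff restrict_def PiE_def extensional_def)
  with c show "(\<forall>b\<in>B. \<exists>a'. rotation \<alpha> b t \<in> P a') \<and> \<phi> (\<lambda>b\<in>B. coding \<alpha> P t b) = a" by auto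
next
  assume R: "(\<forall>b\<in>B. \<exists>a'. rotation \<alpha> b t \<in> P a') \<and> \<phi> (\<lambda>b\<in>B. coding \<alpha> P t b) = a"
  then have "rotation \<alpha> b t \<in> P (coding \<alpha> P t b)" if "b \<in> B" for b
    using that coding_eqI[OF assms] by metis
  with R show "t \<in> induced_map \<alpha> B \<phi> P a"
    unfolding induced_map_iff by (intro bexI[of _ "\<lambda>b\<in>B. coding \<alpha> P t b"]) auto
qed

lemma disjoint_induced_map: "disjoint_family P \<Longrightarrow> disjoint_family (induced_map \<alpha> B \<phi> P)"
  by (auto simp: disjoint_family_on_def[of "induced_map \<alpha> B \<phi> P"] induced_map_iff_coding)

lemma induced_map_measurable:
  assumes "finite B" "P \<in> measurable_partitions"
  shows "induced_map \<alpha> B \<phi> P \<in> measurable_partitions"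
proof -
  from assms(2) have P: "disjoint_family P" "\<And>a. P a \<in> sets torus_measure"
    "AE t in torus_measure. \<exists>a. t \<in> P a" by (auto simp: measurable_partitions_iff)
  have "induced_map \<alpha> B \<phi> P a \<in> sets torus_measure" for a
  proof -
    have "(\<Inter>b\<in>B. rotation \<alpha> (- b) ` P (c b)) \<in> sets torus_measure" for c
    proof (cases "B = {}")
      case False
      then show ?thesis using assms(1) P(2)
        by (intro sets.finite_INT) (auto simp: rotation_image sets_rotation)
    qed simp
    then show ?thesis unfolding induced_map_def
      by (intro sets.finite_UN) (auto intro: finite_subset[OF _ finite_PiE[OF assms(1)]])
  qed
  moreover have "AE t in torus_measure. \<exists>a. t \<in> induced_map \<alpha> B \<phi> P a"
    using AE_rotation[OF P(3), of \<alpha>] by eventually_elim (simp add: induced_map_iff_coding[OF P(1)])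
  ultimately show ?thesis using disjoint_induced_map[OF P(1)] by (simp add: measurable_partitions_iff)
qed

lemma open_induced_map:
  assumes "finite B" "\<And>a. open (P a)"
  shows "open (induced_map \<alpha> B \<phi> P a)"
  unfolding induced_map_def using assms
  by (intro open_UN ballI open_INT) (auto simp: rotation_image open_rotation)

lemma
  assumes "disjoint_family P" "t \<in> coding_domain \<alpha> P"
  shows coding_domain_induced_map: "t \<in> coding_domain \<alpha> (induced_map \<alpha> B \<phi> P)"
    and coding_induced_map: "coding \<alpha> (induced_map \<alpha> B \<phi> P) t = cellular_automaton B \<phi> (coding \<alpha> P t)"
proof -
  have *: "rotation \<alpha> z t \<in> induced_map \<alpha> B \<phi> P (\<phi> (\<lambda>b\<in>B. coding \<alpha> P t (b + z)))" for z
    using assms by (simp add: induced_map_iff_coding coding_rotation mem_coding_domain)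
  then show "t \<in> coding_domain \<alpha> (induced_map \<alpha> B \<phi> P)" by (auto simp: mem_coding_domain)
  show "coding \<alpha> (induced_map \<alpha> B \<phi> P) t = cellular_automaton B \<phi> (coding \<alpha> P t)"
    using coding_eqI[OF disjoint_induced_map[OF assms(1)] *]
    by (auto simp: cellular_automaton_def add.commute)
qed

section \<open>Minimality of the rotation\<close>

locale minimal_rotation =
  fixes \<alpha> :: "'k::finite torus"
  assumes inj_orbit: "inj (\<lambda>z. torus_zmult z \<alpha>)"
    and dense_orbit: "closure (range (\<lambda>z. torus_zmult z \<alpha>)) = UNIV"
begin

text \<open>Every orbit is a translate of the dense orbit of \<open>0\<close>.\<close>

lemma orbit_meets_open:
  assumes "open V" "V \<noteq> {}"
  shows "\<exists>z. rotation \<alpha> z t \<in> V"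
proof -
  obtain v where "v \<in> V" using assms(2) by blast
  let ?U = "{s. s + t \<in> V}"
  have "open ?U" using open_vimage_translation[OF assms(1), of t] by (simp add: vimage_def)
  moreover have "v - t \<in> ?U" using \<open>v \<in> V\<close> by simp
  moreover have "?U \<inter> closure (range (\<lambda>z. torus_zmult z \<alpha>)) \<noteq> {}"
    using dense_orbit \<open>v - t \<in> ?U\<close> by blast
  ultimately have "?U \<inter> range (\<lambda>z. torus_zmult z \<alpha>) \<noteq> {}"
    using open_Int_closure_eq_empty by blast
  then show ?thesis by (auto simp: rotation_def add.commute)
qed

text \<open>Compactness makes minimality uniform: finitely many translates of \<open>V\<close> cover the torus, so the time
  needed to reach \<open>V\<close> is bounded, from any point and starting at any time.\<close>

lemma visits_syndetic:
  assumes "open V" "V \<noteq> {}"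
  obtains L :: nat where "L > 0" "\<And>t x. \<exists>z\<in>{x..<x + int L}. rotation \<alpha> z t \<in> V"
proof -
  have "UNIV \<subseteq> (\<Union>z. {t. rotation \<alpha> z t \<in> V})" using orbit_meets_open[OF assms] by auto
  then obtain D where D: "finite D" "UNIV \<subseteq> (\<Union>z\<in>D. {t. rotation \<alpha> z t \<in> V})"
    using compactE_image[OF compact_UNIV_torus, of UNIV "\<lambda>z. {t. rotation \<alpha> z t \<in> V}"]
      open_rotation[OF assms(1)] by (metis subset_UNIV)
  obtain m where m: "\<And>z. z \<in> D \<Longrightarrow> nat \<bar>z\<bar> \<le> m"
    using finite_nat_set_iff_bounded_le[of "(\<lambda>z. nat \<bar>z\<bar>) ` D"] D(1) by auto
  have "\<exists>z\<in>{x..<x + int (2 * m + 1)}. rotation \<alpha> z t \<in> V" for t x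
  proof -
    obtain z where z: "z \<in> D" "rotation \<alpha> z (rotation \<alpha> (x + int m) t) \<in> V" using D(2) by blast
    then show ?thesis using m[OF z(1)] by (intro bexI[of _ "z + (x + int m)"]) auto
  qed
  then show ?thesis using that[of "2 * m + 1"] by simp
qed

text \<open>A nonempty open set is not negligible: otherwise almost every point would have an orbit that avoids
  it, although every orbit meets it.\<close>

lemma AE_witness_in_open:
  assumes "open U" "U \<noteq> {}" "AE t in (torus_measure :: 'k torus measure). Q t"
  shows "\<exists>t\<in>U. Q t"
proof (rule ccontr)
  assume "\<not> (\<exists>t\<in>U. Q t)"
  then have "AE t in (torus_measure :: 'k torus measure). t \<notin> U" using assms(3) by (auto elim: eventually_mono)
  then have "AE t in (torus_measure :: 'k torus measure). \<forall>z. rotation \<alpha> z t \<notin> U" by (rule AE_rotation)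
  then have "AE t in (torus_measure :: 'k torus measure). False"
    by (rule eventually_mono) (use orbit_meets_open[OF assms(1,2)] in blast)
  then show False by simp
qed

text \<open>Density of an open partition is a consequence of full measure, since the complement of the closure
  is an open set of measure \<open>0\<close>.\<close>

lemma open_partitions_iff:
  "P \<in> open_partitions \<longleftrightarrow> disjoint_family P \<and> (\<forall>a. open (P a)) \<and>
    (AE t in (torus_measure :: 'k torus measure). \<exists>a. t \<in> P a)"
proof -
  have "closure (\<Union>a. P a) = UNIV" if "AE t in (torus_measure :: 'k torus measure). \<exists>a. t \<in> P a"
  proof (rule ccontr)
    assume "closure (\<Union>a. P a) \<noteq> UNIV"
    then have "\<exists>t\<in>- closure (\<Union>a. P a). \<exists>a. t \<in> P a"
      using that by (intro AE_witness_in_open) auto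
    then show False using closure_subset[of "\<Union>a. P a"] by blast
  qed
  then show ?thesis by (auto simp: open_partitions_def measurable_partitions_iff)
qed

lemma induced_map_open:
  assumes "finite B" "P \<in> open_partitions"
  shows "induced_map \<alpha> B \<phi> P \<in> open_partitions"
proof -
  have "P \<in> measurable_partitions" using assms(2) by (simp add: open_partitions_def)
  then have "induced_map \<alpha> B \<phi> P \<in> measurable_partitions" by (rule induced_map_measurable[OF assms(1)])
  then show ?thesis
    using open_induced_map[OF assms(1), of P] assms(2)
    by (simp add: open_partitions_iff measurable_partitions_iff)
qed

text \<open>If two points of an orbit, \<open>i - j\<close> steps apart, both have norm below \<open>\<delta>\<close>, then the norm of
  \<open>(i - j) \<alpha>\<close> is below \<open>2 \<delta>\<close>. As \<open>\<alpha>\<close> has infinite order, this fails for the finitely many short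
  nonzero differences once \<open>\<delta>\<close> is small.\<close>

lemma separated_visits:
  obtains \<delta> where "\<delta> > 0"
    "\<And>t i j. torus_norm (rotation \<alpha> i t) < \<delta> \<Longrightarrow> torus_norm (rotation \<alpha> j t) < \<delta> \<Longrightarrow>
      \<bar>i - j\<bar> < int n \<Longrightarrow> i = j"
proof -
  let ?Z = "insert 1 ({- int n..int n} - {0})"
  \<comment> \<open>The element \<open>1\<close> only keeps the set nonempty when \<open>n = 0\<close>.\<close>
  define \<mu> where "\<mu> = Min ((\<lambda>z. torus_norm (torus_zmult z \<alpha>)) ` ?Z)"
  have "torus_norm (torus_zmult z \<alpha>) > 0" if "z \<noteq> 0" for z
  proof -
    have "torus_zmult z \<alpha> \<noteq> torus_zmult 0 \<alpha>" using inj_orbit that by (auto dest: injD)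
    then show ?thesis
      using torus_norm_nonneg[of "torus_zmult z \<alpha>"] torus_norm_zero_iff[of "torus_zmult z \<alpha>"]
      by (simp add: torus_zmult_0)
  qed
  then have pos: "\<mu> > 0" unfolding \<mu>_def by (subst Min_gr_iff) auto
  have "i = j" if "torus_norm (rotation \<alpha> i t) < \<mu> / 2" "torus_norm (rotation \<alpha> j t) < \<mu> / 2" "\<bar>i - j\<bar> < int n"
    for t i j
  proof (rule ccontr)
    assume "i \<noteq> j"
    then have "\<mu> \<le> torus_norm (torus_zmult (i - j) \<alpha>)"
      unfolding \<mu>_def using that(3) by (intro Min_le imageI) auto
    also have "torus_zmult (i - j) \<alpha> = rotation \<alpha> i t - rotation \<alpha> j t"
      using torus_zmult_add[of "i - j" j \<alpha>] by (simp add: rotation_def)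
    also have "torus_norm \<dots> \<le> torus_norm (rotation \<alpha> i t) + torus_norm (rotation \<alpha> j t)"
      by (rule torus_norm_diff)
    finally show False using that(1,2) by simp
  qed
  then show ?thesis using that[of "\<mu> / 2"] pos by simp
qed

text \<open>The first \<open>n\<close> translates of the ball are disjoint and have equal measure.\<close>

lemma measure_separated_ball:
  assumes "n > 0" and sep: "\<And>t i j. torus_norm (rotation \<alpha> i t) < c \<Longrightarrow> torus_norm (rotation \<alpha> j t) < c \<Longrightarrow>
      \<bar>i - j\<bar> < int n \<Longrightarrow> i = j"
  shows "measure torus_measure {t :: 'k torus. torus_norm t < c} \<le> 1 / n"
proof -
  let ?J = "{t :: 'k torus. torus_norm t < c}"
  let ?R = "\<lambda>i::nat. {t. rotation \<alpha> (int i) t \<in> ?J}"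
  have J: "?J \<in> sets torus_measure" by (intro open_sets_torus open_torus_ball)
  have "disjoint_family_on ?R {..<n}"
    unfolding disjoint_family_on_def
  proof (intro ballI impI)
    fix i j assume "i \<in> {..<n}" "j \<in> {..<n}" "i \<noteq> j"
    then show "?R i \<inter> ?R j = {}" using sep[of "int i" _ "int j"] by fastforce
  qed
  then have "measure torus_measure (\<Union>i<n. ?R i) = (\<Sum>i<n. measure torus_measure (?R i))"
    using sets_rotation[OF J] by (intro torus.finite_measure_finite_Union) auto
  also have "\<dots> = n * measure torus_measure ?J" using measure_rotation[OF J] by simp
  finally have "n * measure torus_measure ?J \<le> 1" by (metis torus.prob_le_1)
  then show ?thesis using assms(1) by (simp add: field_simps)
qed

text \<open>Surround the points \<open>z \<alpha>\<close> with \<open>\<bar>z\<bar> \<le> m\<close> by disjoint balls of a common radius, label the ball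
  at \<open>z \<alpha>\<close> by \<open>y z\<close> and give the exterior of all balls an arbitrary label. Rotating the ball at \<open>0\<close>
  by \<open>z \<alpha>\<close> gives the ball at \<open>z \<alpha>\<close>, so the ball at \<open>0\<close> serves as \<open>V\<close>.\<close>

lemma open_partition_prescribed_word:
  fixes y :: "int \<Rightarrow> 'a::finite"
  obtains P V where "P \<in> open_partitions" "open V" "V \<noteq> {}"
    "\<And>t z. t \<in> V \<Longrightarrow> \<bar>z\<bar> \<le> int m \<Longrightarrow> rotation \<alpha> z t \<in> P (y z)"
proof -
  obtain \<delta> where \<delta>: "\<delta> > 0"
    "\<And>t i j. torus_norm (rotation \<alpha> i t) < \<delta> \<Longrightarrow> torus_norm (rotation \<alpha> j t) < \<delta> \<Longrightarrow>
      \<bar>i - j\<bar> < int (2 * m + 1) \<Longrightarrow> i = j" using separated_visits by blast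
  obtain c where c: "0 < c" "c < \<delta>" "AE t in torus_measure. torus_norm (t :: 'k torus) \<noteq> c"
    using ex_generic_radius[OF \<delta>(1), of "{}"] by auto
  let ?Z = "{- int m..int m}"
  let ?out = "{t. \<forall>z\<in>?Z. torus_norm (rotation \<alpha> (- z) t) > c}"
  define P where "P a = (\<Union>z\<in>{z\<in>?Z. y z = a}. {t. torus_norm (rotation \<alpha> (- z) t) < c}) \<union>
      (if a = y 0 then ?out else {})" for a
  have one: "z = z'" if "torus_norm (rotation \<alpha> (- z) t) < c" "torus_norm (rotation \<alpha> (- z') t) < c" "z \<in> ?Z" "z' \<in> ?Z" for z z' t
    using \<delta>(2)[of "-z" t "-z'"] that c(2) by auto
  \<comment> \<open>\<open>?out\<close> is disjoint from all balls, and distinct balls are disjoint, so a point has one label.\<close>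
  have PD: "t \<in> P a \<longleftrightarrow> (\<exists>z\<in>?Z. y z = a \<and> torus_norm (rotation \<alpha> (- z) t) < c) \<or> a = y 0 \<and> t \<in> ?out" for t a
    by (auto simp: P_def)
  have "a = b" if t: "t \<in> P a" "t \<in> P b" for t a b
  proof (cases "t \<in> ?out")
    case True
    then show ?thesis using t unfolding PD by fastforce
  next
    case False
    then show ?thesis using t one unfolding PD by blast
  qed
  then have "disjoint_family P" unfolding disjoint_family_on_def by blast
  moreover have "open (P a)" for a
  proof -
    have "?out = (\<Inter>z\<in>?Z. {t. rotation \<alpha> (- z) t \<in> {t. torus_norm t > c}})" by auto
    also have "open \<dots>" by (intro open_INT ballI open_rotation open_torus_ball_exterior) simp
    finally have "open ?out" .
    moreover have "open {t. torus_norm (rotation \<alpha> (- z) t) < c}" for z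
      using open_rotation[OF open_torus_ball] by simp
    ultimately show ?thesis unfolding P_def by auto
  qed
  moreover have "AE t in torus_measure. \<exists>a. t \<in> P a"
    using AE_rotation[OF c(3), of \<alpha>]
  proof eventually_elim
    case (elim t)
    show ?case
    proof (cases "t \<in> ?out")
      case True then show ?thesis unfolding PD by blast
    next
      case False
      then obtain z where z: "z \<in> ?Z" "\<not> torus_norm (rotation \<alpha> (- z) t) > c" by blast
      then have "torus_norm (rotation \<alpha> (- z) t) < c"
        using elim[rule_format, of "- z"] by linarith
      then show ?thesis unfolding PD using z(1) by blast
    qed
  qed
  ultimately have "P \<in> open_partitions" by (simp add: open_partitions_iff)
  moreover have "rotation \<alpha> z t \<in> P (y z)" if "torus_norm t < c" "\<bar>z\<bar> \<le> int m" for t z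
    unfolding PD using that by (intro disjI1 bexI[of _ z]) auto
  ultimately show ?thesis
    using c(1) by (intro that[of P "{t. torus_norm t < c}"] open_torus_ball torus_ball_nonempty) auto
qed

end

section \<open>Metrics on sequences\<close>

lemma cantor_dist_less_iff:
  "cantor_dist p q < (1 / 2) ^ m \<longleftrightarrow> (\<forall>z. \<bar>z\<bar> \<le> int m \<longrightarrow> p z = q z)"
proof
  assume less: "cantor_dist p q < (1 / 2) ^ m"
  show "\<forall>z. \<bar>z\<bar> \<le> int m \<longrightarrow> p z = q z"
  proof (intro allI impI, rule ccontr)
    fix z assume z: "\<bar>z\<bar> \<le> int m" "p z \<noteq> q z"
    then have "(LEAST n. \<exists>z. p z \<noteq> q z \<and> n = nat \<bar>z\<bar>) \<le> m"
      by (intro order_trans[OF Least_le[of _ "nat \<bar>z\<bar>"]]) auto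
    then have "(1 / 2) ^ m \<le> cantor_dist p q"
      using z(2) by (auto simp: cantor_dist_def intro!: power_decreasing)
    with less show False by simp
  qed
next
  assume agree: "\<forall>z. \<bar>z\<bar> \<le> int m \<longrightarrow> p z = q z"
  show "cantor_dist p q < (1 / 2) ^ m"
  proof (cases "p = q")
    case False
    then obtain z where "p z \<noteq> q z" by auto
    then have "\<exists>n. \<exists>z. p z \<noteq> q z \<and> n = nat \<bar>z\<bar>" by auto
    from LeastI_ex[OF this] obtain z where
      z: "p z \<noteq> q z" "(LEAST n. \<exists>z. p z \<noteq> q z \<and> n = nat \<bar>z\<bar>) = nat \<bar>z\<bar>" by blast
    then have "m < (LEAST n. \<exists>z. p z \<noteq> q z \<and> n = nat \<bar>z\<bar>)" using agree by force
    then show ?thesis using False by (simp add: cantor_dist_def power_strict_decreasing)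
  qed (simp add: cantor_dist_def)
qed

lemma besicovitch_dist_le:
  assumes "0 \<le> c"
    "\<forall>\<^sub>F N in sequentially. card {z \<in> {- int N..<int N}. p z \<noteq> q z} / (2 * real N) \<le> c"
  shows "besicovitch_dist p q \<le> c"
proof -
  let ?L = "limsup (\<lambda>N. ereal (real (card {z \<in> {- int N..<int N}. p z \<noteq> q z}) / (2 * real N)))"
  have "?L \<le> ereal c" using assms(2) by (intro Limsup_bounded) simp
  then show ?thesis unfolding besicovitch_dist_def using assms(1) by (cases ?L) auto
qed

lemma besicovitch_dist_ge:
  assumes "\<forall>\<^sub>F N in sequentially. c \<le> card {z \<in> {- int N..<int N}. p z \<noteq> q z} / (2 * real N)"
  shows "c \<le> besicovitch_dist p q"
proof -
  let ?f = "\<lambda>N. real (card {z \<in> {- int N..<int N}. p z \<noteq> q z}) / (2 * real N)"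
  let ?L = "limsup (\<lambda>N. ereal (?f N))"
  have "?f N \<le> 1" for N
  proof -
    have "card {z \<in> {- int N..<int N}. p z \<noteq> q z} \<le> card {- int N..<int N}"
      by (intro card_mono) auto
    then show ?thesis by (cases "N = 0") (auto simp: field_simps)
  qed
  then have "?L \<le> ereal 1" by (intro Limsup_bounded) (simp add: always_eventually)
  moreover have "ereal c \<le> ?L" using assms by (intro le_Limsup) auto
  ultimately show ?thesis unfolding besicovitch_dist_def by (cases ?L) auto
qed

text \<open>Each block of \<open>n\<close> consecutive integers contains at most one element of \<open>S\<close>.\<close>

lemma card_separated_le:
  assumes "n > 0" "S \<subseteq> {- int N..<int N}"
    and sep: "\<And>i j. i \<in> S \<Longrightarrow> j \<in> S \<Longrightarrow> \<bar>i - j\<bar> < int n \<Longrightarrow> i = j"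
  shows "card S \<le> 2 * N div n + 1"
proof -
  let ?f = "\<lambda>z. nat (z + int N) div n"
  have "inj_on ?f S"
  proof (rule inj_onI)
    fix i j assume ij: "i \<in> S" "j \<in> S" "?f i = ?f j"
    have "int (nat (i + int N)) = i + int N" "int (nat (j + int N)) = j + int N"
      using ij assms(2) by auto
    moreover have "\<bar>int a - int b\<bar> < int n" if "a div n = b div n" for a b
    proof -
      have "a = a div n * n + a mod n" "b = a div n * n + b mod n" using that by (metis div_mult_mod_eq)+
      moreover have "a mod n < n" "b mod n < n" using assms(1) by auto
      ultimately show ?thesis by linarith
    qed
    ultimately show "i = j" using sep[OF ij(1,2)] ij(3) by fastforce
  qed
  moreover have "?f ` S \<subseteq> {..2 * N div n}" using assms(2) by (force intro!: div_le_mono)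
  ultimately have "card S \<le> card {..2 * N div n}" by (intro card_inj_on_le) auto
  then show ?thesis by simp
qed

text \<open>Each of the \<open>2 * N div M\<close> disjoint full blocks of length \<open>M\<close> contributes an element.\<close>

lemma card_syndetic_ge:
  assumes "M > 0" and syn: "\<And>x. \<exists>z\<in>{x..<x + int M}. z \<in> S"
  shows "2 * N div M \<le> card {z \<in> {- int N..<int N}. z \<in> S}"
proof -
  let ?x = "\<lambda>i::nat. - int N + int (i * M)"
  obtain f where f: "\<And>i. f i \<in> {?x i..<?x i + int M}" "\<And>i. f i \<in> S"
    using syn[of "?x _"] by metis
  have "inj f"
  proof (rule linorder_injI)
    fix i j :: nat assume "i < j"
    then have "Suc i * M \<le> j * M" by (intro mult_le_mono1) simp
    then have "?x i + int M \<le> ?x j" by (simp flip: of_nat_mult of_nat_add)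
    then show "f i \<noteq> f j" using f(1)[of i] f(1)[of j] by auto
  qed
  moreover have "f ` {..<2 * N div M} \<subseteq> {z \<in> {- int N..<int N}. z \<in> S}"
  proof safe
    fix i assume "i < 2 * N div M"
    then have "Suc i * M \<le> 2 * N div M * M" by (intro mult_le_mono1) simp
    also have "\<dots> \<le> 2 * N" by simp
    finally have "?x i + int M \<le> int N" by (simp flip: of_nat_mult of_nat_add)
    moreover have "- int N \<le> ?x i" by simp
    ultimately show "f i \<in> {- int N..<int N}" using f(1)[of i] by (meson atLeastLessThan_iff order_less_le_trans order_trans)
  qed (rule f(2))
  moreover have "finite {z \<in> {- int N..<int N}. z \<in> S}"
    by (rule finite_subset[of _ "{- int N..<int N}"]) auto
  ultimately show ?thesis
    by (metis (no_types, lifting) card_image card_lessThan card_mono inj_on_subset subset_UNIV)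
qed

section \<open>Cellular automata and orphan words\<close>

lemma finite_int_set_symmetric_bound:
  assumes "finite B" obtains r where "B \<subseteq> {- int r..int r}"
proof -
  obtain r where "\<And>b. b \<in> B \<Longrightarrow> nat \<bar>b\<bar> \<le> r"
    using finite_nat_set_iff_bounded_le[of "(\<lambda>b. nat \<bar>b\<bar>) ` B"] assms by auto
  then have "B \<subseteq> {- int r..int r}" by fastforce
  then show ?thesis by (rule that)
qed

lemma cellular_automaton_shift:
  "cellular_automaton B \<phi> (\<lambda>z. p (z + x)) z = cellular_automaton B \<phi> p (z + x)"
  by (simp add: cellular_automaton_def ac_simps)

lemma cellular_automaton_local:
  assumes "B \<subseteq> {- int r..int r}" "\<And>z. \<bar>z\<bar> \<le> int (m + r) \<Longrightarrow> p z = q z" "\<bar>z\<bar> \<le> int m"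
  shows "cellular_automaton B \<phi> p z = cellular_automaton B \<phi> q z"
proof -
  have "p (z + b) = q (z + b)" if "b \<in> B" for b
  proof -
    have "\<bar>b\<bar> \<le> int r" using that assms(1) by force
    then show ?thesis using assms(3) by (intro assms(2)) linarith
  qed
  then show ?thesis unfolding cellular_automaton_def by (intro arg_cong[of _ _ \<phi>] restrict_ext)
qed

text \<open>The configuration space is compact and an automaton depends on finitely many coordinates at a time.
  If every finite window of \<open>y\<close> occurred in the image, then the preimages of these windows would form a
  decreasing sequence of nonempty closed sets, and a common point would be a preimage of \<open>y\<close>. Hence a
  configuration outside the image has a finite window that occurs nowhere in the image, at any
  position \<open>x\<close> by shift invariance.\<close>

lemma orphan_word:
  fixes \<phi> :: "(int \<Rightarrow> 'a::finite) \<Rightarrow> 'a"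
  assumes "finite B" "\<not> surj (cellular_automaton B \<phi>)"
  obtains y :: "int \<Rightarrow> 'a" and m :: nat
  where "\<And>p x. \<exists>z. \<bar>z\<bar> \<le> int m \<and> cellular_automaton B \<phi> p (z + x) \<noteq> y z"
proof -
  obtain y where y: "y \<notin> range (cellular_automaton B \<phi>)" using assms(2) by auto
  let ?X = "product_topology (\<lambda>_::int. discrete_topology (UNIV :: 'a set)) UNIV"
  define C where "C m = {p. \<forall>z\<in>{- int m..int m}. cellular_automaton B \<phi> p z = y z}" for m :: nat
  have top: "topspace ?X = UNIV" by simp
  have coord: "closedin ?X {p. p j = a}" for j a
  proof -
    have "closedin ?X {p \<in> topspace ?X. p j \<in> {a}}"
      by (rule closedin_continuous_map_preimage[OF continuous_map_product_projection]) auto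
    then show ?thesis by simp
  qed
  have "closedin ?X {p. cellular_automaton B \<phi> p z = y z}" for z
  proof -
    have "closedin ?X {p. \<forall>b\<in>B. p (z + b) = c b}" for c
    proof -
      have "closedin ?X (\<Inter>(insert UNIV ((\<lambda>b. {p. p (z + b) = c b}) ` B)))"
        using coord closedin_topspace[of ?X] unfolding top by (intro closedin_Inter) auto
      then show ?thesis by (simp add: INTER_eq)
    qed
    then have "closedin ?X (\<Union>c\<in>{c \<in> B \<rightarrow>\<^sub>E UNIV. \<phi> c = y z}. {p. \<forall>b\<in>B. p (z + b) = c b})"
      using finite_PiE[OF assms(1), of "\<lambda>_. UNIV :: 'a set"] by (intro closedin_Union) auto
    moreover have "(\<Union>c\<in>{c \<in> B \<rightarrow>\<^sub>E UNIV. \<phi> c = y z}. {p. \<forall>b\<in>B. p (z + b) = c b})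
        = {p. cellular_automaton B \<phi> p z = y z}" (is "?U = ?E")
    proof (intro set_eqI iffI)
      fix p assume "p \<in> ?U"
      then obtain c where c: "c \<in> B \<rightarrow>\<^sub>E UNIV" "\<phi> c = y z" "\<forall>b\<in>B. p (z + b) = c b" by blast
      then have "(\<lambda>b\<in>B. p (z + b)) = c" by (auto simp: fun_eq_iff restrict_def PiE_def extensional_def)
      with c show "p \<in> ?E" by (simp add: cellular_automaton_def)
    next
      fix p assume "p \<in> ?E"
      then show "p \<in> ?U"
        by (intro UN_I[of "\<lambda>b\<in>B. p (z + b)"]) (auto simp: cellular_automaton_def)
    qed
    ultimately show ?thesis by simp
  qed
  then have "closedin ?X (\<Inter>z\<in>{- int m..int m}. {p. cellular_automaton B \<phi> p z = y z})" for m
    by (intro closedin_INT) auto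
  moreover have "C m = (\<Inter>z\<in>{- int m..int m}. {p. cellular_automaton B \<phi> p z = y z})" for m
    by (auto simp: C_def)
  ultimately have closed: "closedin ?X (C m)" for m by simp
  have "\<exists>m. C m = {}"
  proof (rule ccontr)
    assume "\<nexists>m. C m = {}"
    moreover have "compact_space ?X"
      by (simp add: compact_space_product_topology compact_space_discrete_topology)
    moreover have "decseq C" by (rule decseq_SucI) (auto simp: C_def)
    ultimately have "(\<Inter>m. C m) \<noteq> {}" using closed by (intro compact_space_imp_nest) auto
    then obtain p where p: "\<And>m. p \<in> C m" by auto
    have "cellular_automaton B \<phi> p z = y z" for z
      using p[of "nat \<bar>z\<bar>"] unfolding C_def by (auto dest!: bspec[of _ _ z])
    with y show False by (metis ext rangeI)
  qed
  then obtain m where m: "C m = {}" by blast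
  show ?thesis
  proof
    fix p x
    have "(\<lambda>z. p (z + x)) \<notin> C m" using m by simp
    then show "\<exists>z. \<bar>z\<bar> \<le> int m \<and> cellular_automaton B \<phi> p (z + x) \<noteq> y z"
      by (auto simp: C_def cellular_automaton_shift abs_le_iff)
  qed
qed

section \<open>Recoding a partition along first returns\<close>

text \<open>The base of the column over the ball of radius \<open>c\<close> whose points return to the ball for the first time
  after \<open>length w\<close> steps and spell \<open>w\<close> on the way. Words are lists, so that there are countably many
  columns. The strict inequality \<open>c < torus_norm _\<close> before the return keeps the cells of an open
  partition open; the points lost in this way have an orbit that meets the sphere.\<close>

definition return_cell ::
    "'k::finite torus \<Rightarrow> ('a \<Rightarrow> 'k torus set) \<Rightarrow> real \<Rightarrow> 'a list \<Rightarrow> 'k torus set"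
  where "return_cell \<alpha> P c w = {s.
    torus_norm s < c \<and> torus_norm (rotation \<alpha> (int (length w)) s) < c \<and>
    (\<forall>j\<in>{0<..<length w}. c < torus_norm (rotation \<alpha> (int j) s)) \<and>
    (\<forall>j<length w. rotation \<alpha> (int j) s \<in> P (w ! j))}"

text \<open>Read \<open>h\<close> as a right inverse of the automaton on configurations. A column with word \<open>w\<close> is relabelled
  by the first \<open>length w\<close> entries of \<open>h\<close> applied to a configuration that carries \<open>w\<close> on
  \<open>{0..<length w}\<close>; outside this interval the values of the configuration are arbitrary.\<close>

definition recode :: "'k::finite torus \<Rightarrow> ((int \<Rightarrow> 'a) \<Rightarrow> int \<Rightarrow> 'a) \<Rightarrow> real \<Rightarrow>
    ('a \<Rightarrow> 'k torus set) \<Rightarrow> ('a \<Rightarrow> 'k torus set)"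
  where "recode \<alpha> h c P a =
    (\<Union>w. \<Union>i\<in>{i. i < length w \<and> h (\<lambda>z. w ! nat z) (int i) = a}.
      {t. rotation \<alpha> (- int i) t \<in> return_cell \<alpha> P c w})"

lemma mem_recode: "t \<in> recode \<alpha> h c P a \<longleftrightarrow>
    (\<exists>w i. i < length w \<and> rotation \<alpha> (- int i) t \<in> return_cell \<alpha> P c w \<and>
      a = h (\<lambda>z. w ! nat z) (int i))"
  unfolding recode_def by auto

lemma return_cell_alt:
  "return_cell \<alpha> P c w = {t. torus_norm t < c} \<inter>
    {t. rotation \<alpha> (int (length w)) t \<in> {t. torus_norm t < c}} \<inter>
    (\<Inter>j\<in>{0<..<length w}. {t. rotation \<alpha> (int j) t \<in> {t. c < torus_norm t}}) \<inter>
    (\<Inter>j\<in>{..<length w}. {t. rotation \<alpha> (int j) t \<in> P (w ! j)})"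
  by (auto simp: return_cell_def)

lemma open_return_cell:
  assumes "\<And>a. open (P a)" shows "open (return_cell \<alpha> P c w)"
  unfolding return_cell_alt
  by (intro open_Int open_INT ballI open_rotation open_torus_ball open_torus_ball_exterior assms) simp_all

lemma sets_return_cell:
  assumes "\<And>a. P a \<in> sets torus_measure" shows "return_cell \<alpha> P c w \<in> sets torus_measure"
  unfolding return_cell_alt
  by (intro sets.Int sets.countable_INT'' sets_rotation open_sets_torus open_torus_ball
      open_torus_ball_exterior assms) simp_all

lemma open_recode: "(\<And>a. open (P a)) \<Longrightarrow> open (recode \<alpha> h c P a)"
  unfolding recode_def by (intro open_UN ballI open_rotation open_return_cell)

lemma sets_recode:
  fixes P :: "'a::finite \<Rightarrow> 'k::finite torus set"
  assumes "\<And>a. P a \<in> sets torus_measure" shows "recode \<alpha> h c P a \<in> sets torus_measure"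
  unfolding recode_def
  by (intro sets.countable_UN'' sets_rotation sets_return_cell assms) (rule countableI_type)+

text \<open>Going back from \<open>t\<close>, the base of the column is the first visit to the ball. Then the first return
  determines the length of the word, and the partition determines its letters.\<close>

lemma return_cell_unique:
  assumes P: "disjoint_family P"
    and w: "i < length w" "rotation \<alpha> (- int i) t \<in> return_cell \<alpha> P c w"
    and w': "i' < length w'" "rotation \<alpha> (- int i') t \<in> return_cell \<alpha> P c w'"
  shows "i = i' \<and> w = w'"
proof -
  have no_visit: False
    if "i1 < i2" "i2 < length w2" "rotation \<alpha> (- int i1) t \<in> return_cell \<alpha> P c w1"
      "rotation \<alpha> (- int i2) t \<in> return_cell \<alpha> P c w2" for i1 i2 w1 w2
  proof -
    have "i2 - i1 \<in> {0<..<length w2}" using that by auto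
    then have "c < torus_norm (rotation \<alpha> (int (i2 - i1)) (rotation \<alpha> (- int i2) t))"
      using that(4) unfolding return_cell_def by blast
    moreover have "int (i2 - i1) - int i2 = - int i1" using that(1) by simp
    ultimately show False using that(3) by (simp add: return_cell_def)
  qed
  have i: "i = i'" using no_visit[OF _ w'(1) w(2) w'(2)] no_visit[OF _ w(1) w'(2) w(2)] by fastforce
  let ?s = "rotation \<alpha> (- int i) t"
  have no_shorter: "\<not> length w1 < length w2"
    if "?s \<in> return_cell \<alpha> P c w1" "?s \<in> return_cell \<alpha> P c w2" "0 < length w1" for w1 w2
  proof
    assume "length w1 < length w2"
    with that(3) have "length w1 \<in> {0<..<length w2}" by simp
    then have "c < torus_norm (rotation \<alpha> (int (length w1)) ?s)"
      using that(2) unfolding return_cell_def by blast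
    then show False using that(1) by (simp add: return_cell_def)
  qed
  have len: "length w = length w'"
    using no_shorter[OF w(2), of w'] no_shorter[of w' w] w w' i by force
  have "w ! j = w' ! j" if "j < length w" for j
  proof -
    have "rotation \<alpha> (int j) ?s \<in> P (w ! j)" "rotation \<alpha> (int j) ?s \<in> P (w' ! j)"
      using w(2) w'(2) that len i by (simp_all add: return_cell_def)
    then show ?thesis using P by (auto simp: disjoint_family_on_def)
  qed
  with i len show ?thesis by (simp add: list_eq_iff_nth_eq)
qed

lemma disjoint_recode:
  assumes "disjoint_family P" shows "disjoint_family (recode \<alpha> h c P)"
proof -
  have "a = b" if "t \<in> recode \<alpha> h c P a" "t \<in> recode \<alpha> h c P b" for t a b
    using that return_cell_unique[OF assms] unfolding mem_recode by metis
  then show ?thesis unfolding disjoint_family_on_def by blast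
qed

text \<open>If the orbit of \<open>t\<close> stays away from the ball for \<open>r\<close> steps in both directions, then the whole
  neighbourhood of \<open>t\<close> lies in one column. There the new labels are a segment of \<open>h\<close> applied to a
  configuration containing \<open>w\<close>, and the automaton turns them back into \<open>w\<close>.\<close>

lemma induced_map_recode:
  assumes h: "\<And>x. cellular_automaton B \<phi> (h x) = x" and B: "B \<subseteq> {- int r..int r}"
    and w: "i < length w" "rotation \<alpha> (- int i) t \<in> return_cell \<alpha> P c w"
    and far: "\<forall>j. \<bar>j\<bar> \<le> int r \<longrightarrow> \<not> torus_norm (rotation \<alpha> j t) < c"
  shows "t \<in> induced_map \<alpha> B \<phi> (recode \<alpha> h c P) (w ! i)"
proof -
  let ?p = "h (\<lambda>z. w ! nat z)"
  have visits: "torus_norm (rotation \<alpha> (- int i) t) < c" "torus_norm (rotation \<alpha> (int (length w) - int i) t) < c"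
    using w(2) by (simp_all add: return_cell_def)
  have inner: "int r < int i" "int r < int (length w) - int i"
    using far[rule_format, of "- int i"] far[rule_format, of "int (length w) - int i"] visits w(1) by fastforce+
  have "rotation \<alpha> b t \<in> recode \<alpha> h c P (?p (int i + b))" if "b \<in> B" for b
  proof -
    have b: "\<bar>b\<bar> \<le> int r" using that B by force
    let ?i = "nat (int i + b)"
    have i: "int ?i = int i + b" "?i < length w" using inner b by auto
    have "rotation \<alpha> (- int ?i) (rotation \<alpha> b t) = rotation \<alpha> (- int i) t" using i(1) by simp
    then show ?thesis unfolding mem_recode using w(2) i by (intro exI[of _ w] exI[of _ ?i]) simp
  qed
  moreover have "\<phi> (\<lambda>b\<in>B. ?p (int i + b)) = w ! i"
    using fun_cong[OF h[of "\<lambda>z. w ! nat z"], of "int i"] by (simp add: cellular_automaton_def)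
  ultimately show ?thesis unfolding induced_map_iff
    by (intro bexI[of _ "\<lambda>b\<in>B. ?p (int i + b)"]) auto
qed

context minimal_rotation
begin

text \<open>By minimality the orbit visits the ball in the past and strictly in the future. The last visit up to
  time \<open>0\<close> and the first one after it delimit the column of \<open>t\<close>.\<close>

lemma ex_return_cell:
  assumes "0 < c" "t \<in> coding_domain \<alpha> P" "\<forall>z. torus_norm (rotation \<alpha> z t) \<noteq> c"
  shows "\<exists>w i. i < length w \<and> rotation \<alpha> (- int i) t \<in> return_cell \<alpha> P c w"
proof -
  let ?J = "{t :: 'k torus. torus_norm t < c}"
  obtain L :: nat where L: "\<And>t x. \<exists>z\<in>{x..<x + int L}. rotation \<alpha> z t \<in> ?J"
    using visits_syndetic[OF open_torus_ball torus_ball_nonempty[OF assms(1)]] by metis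
  let ?past = "\<lambda>i::nat. torus_norm (rotation \<alpha> (- int i) t) < c"
  let ?future = "\<lambda>j::nat. 0 < j \<and> torus_norm (rotation \<alpha> (int j) t) < c"
  obtain z where "z \<in> {- int L..<- int L + int L}" "rotation \<alpha> z t \<in> ?J" using L by blast
  then have "?past (nat (- z))" by simp
  then have past: "?past (LEAST i. ?past i)" by (rule LeastI)
  obtain z' where "z' \<in> {1..<1 + int L}" "rotation \<alpha> z' t \<in> ?J" using L by blast
  then have "?future (nat z')" by simp
  then have future: "?future (LEAST j. ?future j)" by (rule LeastI)
  define i where "i = (LEAST i. ?past i)"
  define j where "j = (LEAST j. ?future j)"
  have "\<forall>z. \<exists>a. rotation \<alpha> z t \<in> P a" using assms(2) by (simp add: mem_coding_domain)
  then obtain q where q: "\<And>z. rotation \<alpha> z t \<in> P (q z)" by metis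
  define w where "w = map (\<lambda>l. q (int l - int i)) [0..<i + j]"
  have "c < torus_norm (rotation \<alpha> (int l - int i) t)" if l: "0 < l" "l < i + j" for l :: nat
  proof -
    have "\<not> torus_norm (rotation \<alpha> (int l - int i) t) < c"
    proof (cases "l \<le> i")
      case True
      then have "\<not> ?past (i - l)" using l(1) not_less_Least[of "i - l" ?past] by (simp add: i_def)
      moreover have "- int (i - l) = int l - int i" using True by simp
      ultimately show ?thesis by simp
    next
      case False
      then have "\<not> ?future (l - i)" using l(2) not_less_Least[of "l - i" ?future] by (simp add: j_def)
      moreover have "int (l - i) = int l - int i" "0 < l - i" using False by simp_all
      ultimately show ?thesis by simp
    qed
    then show ?thesis using assms(3)[rule_format, of "int l - int i"] by linarith
  qed
  then have "rotation \<alpha> (- int i) t \<in> return_cell \<alpha> P c w"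
    using past future q by (auto simp: return_cell_def w_def simp flip: i_def j_def)
  moreover have "i < length w" using future by (simp add: w_def j_def)
  ultimately show ?thesis by blast
qed

text \<open>The recoded partition is an approximate preimage of \<open>P\<close>, with errors only within \<open>r\<close> steps of a visit
  to a ball that is visited at most once in any \<open>n\<close> consecutive steps. The exceptional points, whose
  orbit meets the sphere, form a null set that does not contain the prescribed point \<open>t\<^sub>0\<close>. The same
  construction thus serves for measurable partitions, for open partitions and for a single
  orbit.\<close>

lemma approximate_preimage:
  fixes P :: "'a::finite \<Rightarrow> 'k torus set"
  assumes "surj (cellular_automaton B \<phi>)" "B \<subseteq> {- int r..int r}" "P \<in> measurable_partitions"
  obtains P' c where "P' \<in> measurable_partitions" "P \<in> open_partitions \<Longrightarrow> P' \<in> open_partitions"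
    "\<And>t i j. torus_norm (rotation \<alpha> i t) < c \<Longrightarrow> torus_norm (rotation \<alpha> j t) < c \<Longrightarrow>
      \<bar>i - j\<bar> < int n \<Longrightarrow> i = j"
    "AE t in torus_measure. torus_norm (t :: 'k torus) \<noteq> c"
    "\<And>z. torus_norm (rotation \<alpha> z t\<^sub>0) \<noteq> c"
    "\<And>t. t \<in> coding_domain \<alpha> P \<Longrightarrow> \<forall>z. torus_norm (rotation \<alpha> z t) \<noteq> c \<Longrightarrow> t \<in> coding_domain \<alpha> P'"
    "\<And>t a. t \<in> coding_domain \<alpha> P \<Longrightarrow> \<forall>z. torus_norm (rotation \<alpha> z t) \<noteq> c \<Longrightarrow>
      \<forall>j. \<bar>j\<bar> \<le> int r \<longrightarrow> \<not> torus_norm (rotation \<alpha> j t) < c \<Longrightarrow>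
      t \<in> P a \<longleftrightarrow> t \<in> induced_map \<alpha> B \<phi> P' a"
proof -
  obtain \<delta> where \<delta>: "\<delta> > 0"
    "\<And>t i j. torus_norm (rotation \<alpha> i t) < \<delta> \<Longrightarrow> torus_norm (rotation \<alpha> j t) < \<delta> \<Longrightarrow>
      \<bar>i - j\<bar> < int n \<Longrightarrow> i = j" using separated_visits by blast
  have "countable (range (\<lambda>z. rotation \<alpha> z t\<^sub>0))" by simp
  from \<delta>(1) this obtain c where c: "0 < c" "c < \<delta>" "AE t in torus_measure. torus_norm (t :: 'k torus) \<noteq> c"
      "\<And>z. torus_norm (rotation \<alpha> z t\<^sub>0) \<noteq> c"
    by (rule ex_generic_radius) auto
  define h where "h = inv (cellular_automaton B \<phi>)"
  have h: "cellular_automaton B \<phi> (h x) = x" for x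
    unfolding h_def using assms(1) by (rule surj_f_inv_f)
  let ?P = "recode \<alpha> h c P"
  have P: "disjoint_family P" "\<And>a. P a \<in> sets torus_measure"
    using assms(3) by (simp_all add: measurable_partitions_iff)
  have disj: "disjoint_family ?P" using P(1) by (rule disjoint_recode)
  have covered: "\<exists>a. t \<in> ?P a" if "t \<in> coding_domain \<alpha> P" "\<forall>z. torus_norm (rotation \<alpha> z t) \<noteq> c" for t
    using ex_return_cell[OF c(1) that] by (auto simp: mem_recode)
  have AE: "AE t in torus_measure. \<exists>a. t \<in> ?P a"
    using AE_coding_domain[OF assms(3), of \<alpha>] AE_rotation[OF c(3), of \<alpha>]
    by eventually_elim (use covered in blast)
  show ?thesis
  proof (rule that[of ?P c])
    show "?P \<in> measurable_partitions"
      using disj AE P(2) by (simp add: measurable_partitions_iff sets_recode)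
    show "?P \<in> open_partitions" if "P \<in> open_partitions"
      using disj AE that by (simp add: open_partitions_iff open_recode)
    show "i = j" if "torus_norm (rotation \<alpha> i t) < c" "torus_norm (rotation \<alpha> j t) < c" "\<bar>i - j\<bar> < int n"
      for t i j using \<delta>(2)[of i t j] that c(2) by simp
    show "t \<in> coding_domain \<alpha> ?P" if t: "t \<in> coding_domain \<alpha> P" "\<forall>z. torus_norm (rotation \<alpha> z t) \<noteq> c" for t
      unfolding mem_coding_domain
      by (intro allI covered rotation_coding_domain t(1)) (simp add: t(2))
    show "t \<in> P a \<longleftrightarrow> t \<in> induced_map \<alpha> B \<phi> ?P a"
      if t: "t \<in> coding_domain \<alpha> P" "\<forall>z. torus_norm (rotation \<alpha> z t) \<noteq> c"
        and far: "\<forall>j. \<bar>j\<bar> \<le> int r \<longrightarrow> \<not> torus_norm (rotation \<alpha> j t) < c" for t a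
    proof -
      obtain w i where w: "i < length w" "rotation \<alpha> (- int i) t \<in> return_cell \<alpha> P c w"
        using ex_return_cell[OF c(1) t] by blast
      have "t \<in> P (w ! i)" using w by (auto simp: return_cell_def)
      moreover have "t \<in> induced_map \<alpha> B \<phi> ?P (w ! i)"
        using h assms(2) w far by (rule induced_map_recode)
      moreover have "a = b" if "t \<in> P a" "t \<in> P b" for a b
        using that P(1) by (auto simp: disjoint_family_on_def)
      moreover have "a = b" if "t \<in> induced_map \<alpha> B \<phi> ?P a" "t \<in> induced_map \<alpha> B \<phi> ?P b" for a b
        using that disjoint_induced_map[OF disj, of \<alpha> B \<phi>] by (auto simp: disjoint_family_on_def)
      ultimately show ?thesis by blast
    qed
  qed (use c in auto)
qed

section \<open>Density of the images\<close>

lemma quasisturmian_intro: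
  "P \<in> open_partitions \<Longrightarrow> t \<in> coding_domain \<alpha> P \<Longrightarrow> coding \<alpha> P t \<in> quasisturmian \<alpha>"
  unfolding quasisturmian_def by blast

lemma cellular_automaton_quasisturmian:
  assumes "finite B"
  shows "cellular_automaton B \<phi> ` quasisturmian \<alpha> \<subseteq> quasisturmian \<alpha>"
proof clarify
  fix p :: "int \<Rightarrow> 'a::finite" assume "p \<in> quasisturmian \<alpha>"
  then obtain P t where P: "P \<in> open_partitions" "t \<in> coding_domain \<alpha> P" "p = coding \<alpha> P t"
    by (auto simp: quasisturmian_def)
  then have "disjoint_family P" by (simp add: open_partitions_iff)
  then show "cellular_automaton B \<phi> p \<in> quasisturmian \<alpha>"
    using coding_induced_map[of P t \<alpha> B \<phi>] coding_domain_induced_map[of P t \<alpha> B \<phi>]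
      quasisturmian_intro[OF induced_map_open[OF assms P(1)]] P(2,3) by metis
qed

text \<open>Every configuration is approximated, so quasisturmian sequences are dense in the full shift.\<close>

lemma quasisturmian_cantor_dense:
  fixes y :: "int \<Rightarrow> 'a::finite"
  shows "\<exists>p\<in>quasisturmian \<alpha>. cantor_dist y p < (1 / 2) ^ m"
proof -
  obtain P :: "'a \<Rightarrow> 'k torus set" and V where P: "P \<in> open_partitions" "open V" "V \<noteq> {}"
    "\<And>t z. t \<in> V \<Longrightarrow> \<bar>z\<bar> \<le> int m \<Longrightarrow> rotation \<alpha> z t \<in> P (y z)"
    using open_partition_prescribed_word[of m y] by blast
  have "P \<in> measurable_partitions" using P(1) by (simp add: open_partitions_def)
  from AE_witness_in_open[OF P(2,3) AE_coding_domain[OF this]]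
  obtain t where t: "t \<in> V" "t \<in> coding_domain \<alpha> P" by blast
  have "disjoint_family P" using P(1) by (simp add: open_partitions_iff)
  then have "cantor_dist y (coding \<alpha> P t) < (1 / 2) ^ m"
    unfolding cantor_dist_less_iff using P(4)[OF t(1)] by (metis coding_eqI)
  then show ?thesis using quasisturmian_intro[OF P(1) t(2)] by blast
qed

text \<open>Automata are continuous and quasisturmian sequences are dense in the full shift, so a surjective
  automaton maps them onto a dense set. Conversely some quasisturmian sequence contains an orphan word
  in its central window, and no image comes close to it.\<close>

lemma surj_iff_cantor_dense:
  fixes \<phi> :: "(int \<Rightarrow> 'a::finite) \<Rightarrow> 'a"
  assumes "finite B"
  defines "\<Phi> \<equiv> cellular_automaton B \<phi>"
  shows "surj \<Phi> \<longleftrightarrow> dense_in cantor_dist (\<Phi> ` quasisturmian \<alpha>) (quasisturmian \<alpha>)"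
proof
  assume surj: "surj \<Phi>"
  obtain r where r: "B \<subseteq> {- int r..int r}" using finite_int_set_symmetric_bound[OF assms(1)] .
  have "\<exists>s\<in>\<Phi> ` quasisturmian \<alpha>. cantor_dist q s < \<epsilon>" if "\<epsilon> > 0" for q :: "int \<Rightarrow> 'a" and \<epsilon>
  proof -
    obtain m where m: "(1 / 2) ^ m < \<epsilon>" using real_arch_pow_inv[of \<epsilon> "1 / 2"] \<open>\<epsilon> > 0\<close> by auto
    obtain p where p: "\<Phi> p = q" using surj by (metis surjD)
    obtain p' where p': "p' \<in> quasisturmian \<alpha>" "cantor_dist p p' < (1 / 2) ^ (m + r)"
      using quasisturmian_cantor_dense by blast
    have "q z = \<Phi> p' z" if "\<bar>z\<bar> \<le> int m" for z
      using cellular_automaton_local[OF r _ that] p'(2) p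
      unfolding cantor_dist_less_iff \<Phi>_def by metis
    then have "cantor_dist q (\<Phi> p') < (1 / 2) ^ m" by (simp add: cantor_dist_less_iff)
    then show ?thesis using p'(1) m by (intro bexI[of _ "\<Phi> p'"]) auto
  qed
  then show "dense_in cantor_dist (\<Phi> ` quasisturmian \<alpha>) (quasisturmian \<alpha>)"
    using cellular_automaton_quasisturmian[OF assms(1)] by (simp add: dense_in_def \<Phi>_def)
next
  assume dense: "dense_in cantor_dist (\<Phi> ` quasisturmian \<alpha>) (quasisturmian \<alpha>)"
  show "surj \<Phi>"
  proof (rule ccontr)
    assume "\<not> surj \<Phi>"
    then obtain y :: "int \<Rightarrow> 'a" and m where
      ym: "\<And>p x. \<exists>z. \<bar>z\<bar> \<le> int m \<and> \<Phi> p (z + x) \<noteq> y z"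
      unfolding \<Phi>_def using orphan_word[OF assms(1)] by metis
    obtain q where q: "q \<in> quasisturmian \<alpha>" "cantor_dist y q < (1 / 2) ^ m"
      using quasisturmian_cantor_dense by blast
    have "\<exists>s\<in>\<Phi> ` quasisturmian \<alpha>. cantor_dist q s < (1 / 2) ^ m"
      using dense q(1) unfolding dense_in_def by simp
    then obtain p where "cantor_dist q (\<Phi> p) < (1 / 2) ^ m" by blast
    then show False using ym[of p 0] q(2) by (auto simp: cantor_dist_less_iff)
  qed
qed

text \<open>The errors lie in the union of \<open>2 r + 1\<close> rotations of a ball of measure at most \<open>1 / n\<close>.\<close>

lemma approximate_preimage_partition_dist:
  fixes P :: "'a::finite \<Rightarrow> 'k torus set"
  assumes "surj (cellular_automaton B \<phi>)" "finite B" "P \<in> measurable_partitions" "\<epsilon> > 0"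
  shows "\<exists>P'\<in>measurable_partitions. (P \<in> open_partitions \<longrightarrow> P' \<in> open_partitions) \<and>
    partition_dist P (induced_map \<alpha> B \<phi> P') < \<epsilon>"
proof -
  obtain r where r: "B \<subseteq> {- int r..int r}" using finite_int_set_symmetric_bound[OF assms(2)] .
  let ?K = "real CARD('a) * (2 * real r + 1)"
  obtain n where n: "?K / \<epsilon> < real n" using reals_Archimedean2 by blast
  have "0 < ?K" by simp
  then have "0 < ?K / \<epsilon>" using assms(4) by (intro divide_pos_pos)
  then have "0 < n" using n by (metis of_nat_0_less_iff order_less_trans)
  obtain P' c where P': "P' \<in> measurable_partitions" "P \<in> open_partitions \<Longrightarrow> P' \<in> open_partitions"
    and sep: "\<And>t i j. torus_norm (rotation \<alpha> i t) < c \<Longrightarrow> torus_norm (rotation \<alpha> j t) < c \<Longrightarrow>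
      \<bar>i - j\<bar> < int n \<Longrightarrow> i = j"
    and c: "AE t in torus_measure. torus_norm (t :: 'k torus) \<noteq> c" "\<And>z. torus_norm (rotation \<alpha> z 0) \<noteq> c"
    and dom: "\<And>t. t \<in> coding_domain \<alpha> P \<Longrightarrow> \<forall>z. torus_norm (rotation \<alpha> z t) \<noteq> c \<Longrightarrow>
      t \<in> coding_domain \<alpha> P'"
    and agree: "\<And>t a. t \<in> coding_domain \<alpha> P \<Longrightarrow> \<forall>z. torus_norm (rotation \<alpha> z t) \<noteq> c \<Longrightarrow>
      \<forall>j. \<bar>j\<bar> \<le> int r \<longrightarrow> \<not> torus_norm (rotation \<alpha> j t) < c \<Longrightarrow>
      t \<in> P a \<longleftrightarrow> t \<in> induced_map \<alpha> B \<phi> P' a"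
    by (rule approximate_preimage[OF assms(1) r assms(3), of n 0]) (rule that)
  let ?Q = "induced_map \<alpha> B \<phi> P'"
  let ?J = "{t :: 'k torus. torus_norm t < c}"
  let ?bad = "\<Union>j\<in>{- int r..int r}. {t. rotation \<alpha> j t \<in> ?J}"
  have J: "?J \<in> sets torus_measure" by (intro open_sets_torus open_torus_ball)
  have "measure torus_measure ?bad \<le> (\<Sum>j\<in>{- int r..int r}. measure torus_measure {t. rotation \<alpha> j t \<in> ?J})"
    using sets_rotation[OF J] by (intro torus.finite_measure_subadditive_finite) auto
  also have "\<dots> = (2 * real r + 1) * measure torus_measure ?J"
    by (simp add: measure_rotation[OF J, simplified])
  also have "\<dots> \<le> (2 * real r + 1) * (1 / n)"
    using measure_separated_ball[OF \<open>0 < n\<close> sep] by (intro mult_left_mono) auto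
  finally have bad: "measure torus_measure ?bad \<le> (2 * real r + 1) / n" by simp
  have "measure torus_measure (sym_diff (P a) (?Q a)) \<le> measure torus_measure ?bad" for a
  proof (rule torus.finite_measure_mono_AE)
    show "AE t in torus_measure. t \<in> sym_diff (P a) (?Q a) \<longrightarrow> t \<in> ?bad"
      using AE_coding_domain[OF assms(3), of \<alpha>] AE_rotation[OF c(1), of \<alpha>]
    proof eventually_elim
      case (elim t)
      have "\<forall>j. \<bar>j\<bar> \<le> int r \<longrightarrow> \<not> torus_norm (rotation \<alpha> j t) < c" if "t \<notin> ?bad"
        using that by (auto simp: abs_le_iff)
      with elim show ?case using agree[of t a] by blast
    qed
    show "?bad \<in> sets torus_measure" using sets_rotation[OF J] by (intro sets.finite_UN) auto
  qed
  then have "partition_dist P ?Q \<le> (\<Sum>a\<in>(UNIV :: 'a set). (2 * real r + 1) / n)"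
    unfolding partition_dist_def using bad by (intro sum_mono) (meson order_trans)
  also have "\<dots> = ?K / n" by simp
  also have "\<dots> < \<epsilon>" using n assms(4) \<open>0 < n\<close> by (simp add: field_simps)
  finally show ?thesis using P' by blast
qed

text \<open>Recode while keeping the orbit of \<open>t\<close> off the sphere; then the same point \<open>t\<close> can be coded by the new
  partition. Every error lies within \<open>r\<close> of a visit to the ball, and visits are at least \<open>n\<close> apart,
  so the density of errors is of order \<open>r / n\<close>.\<close>

lemma approximate_preimage_besicovitch:
  fixes q :: "int \<Rightarrow> 'a::finite"
  assumes "surj (cellular_automaton B \<phi>)" "finite B" "q \<in> quasisturmian \<alpha>" "\<epsilon> > 0"
  shows "\<exists>p\<in>quasisturmian \<alpha>. besicovitch_dist q (cellular_automaton B \<phi> p) < \<epsilon>"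
proof -
  obtain r where r: "B \<subseteq> {- int r..int r}" using finite_int_set_symmetric_bound[OF assms(2)] .
  let ?K = "2 * (2 * real r + 1)"
  obtain n where n: "?K / \<epsilon> < real n" using reals_Archimedean2 by blast
  have "0 < ?K / \<epsilon>" using assms(4) by (intro divide_pos_pos) auto
  then have "0 < n" using n by (metis of_nat_0_less_iff order_less_trans)
  obtain P t where P: "P \<in> open_partitions" "t \<in> coding_domain \<alpha> P" "q = coding \<alpha> P t"
    using assms(3) by (auto simp: quasisturmian_def)
  have Pm: "P \<in> measurable_partitions" using P(1) by (simp add: open_partitions_def)
  obtain P' c where P': "P' \<in> measurable_partitions" "P \<in> open_partitions \<Longrightarrow> P' \<in> open_partitions"
    and sep: "\<And>t i j. torus_norm (rotation \<alpha> i t) < c \<Longrightarrow> torus_norm (rotation \<alpha> j t) < c \<Longrightarrow>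
      \<bar>i - j\<bar> < int n \<Longrightarrow> i = j"
    and c: "AE t in torus_measure. torus_norm (t :: 'k torus) \<noteq> c" "\<And>z. torus_norm (rotation \<alpha> z t) \<noteq> c"
    and dom: "\<And>t. t \<in> coding_domain \<alpha> P \<Longrightarrow> \<forall>z. torus_norm (rotation \<alpha> z t) \<noteq> c \<Longrightarrow>
      t \<in> coding_domain \<alpha> P'"
    and agree: "\<And>t a. t \<in> coding_domain \<alpha> P \<Longrightarrow> \<forall>z. torus_norm (rotation \<alpha> z t) \<noteq> c \<Longrightarrow>
      \<forall>j. \<bar>j\<bar> \<le> int r \<longrightarrow> \<not> torus_norm (rotation \<alpha> j t) < c \<Longrightarrow>
      t \<in> P a \<longleftrightarrow> t \<in> induced_map \<alpha> B \<phi> P' a"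
    by (rule approximate_preimage[OF assms(1) r Pm, of n t]) (rule that)
  let ?p = "coding \<alpha> P' t"
  let ?\<Phi>p = "cellular_automaton B \<phi> ?p"
  have t': "t \<in> coding_domain \<alpha> P'" by (intro dom P(2) allI c(2))
  have Po: "P' \<in> open_partitions" using P'(2) P(1) by blast
  then have disj: "disjoint_family P" "disjoint_family P'"
    using P(1) by (simp_all add: open_partitions_iff)
  define W where "W N j = {z \<in> {- int N..<int N}. torus_norm (rotation \<alpha> (j + z) t) < c}" for N :: nat and j
  have mismatch: "\<exists>j\<in>{- int r..int r}. torus_norm (rotation \<alpha> (j + z) t) < c" if "q z \<noteq> ?\<Phi>p z" for z
  proof (rule ccontr)
    assume "\<not> ?thesis"
    then have far: "\<not> torus_norm (rotation \<alpha> j (rotation \<alpha> z t)) < c" if "\<bar>j\<bar> \<le> int r" for j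
      using that by (auto simp: abs_le_iff)
    obtain a where a: "rotation \<alpha> z t \<in> P a" using P(2) by (auto simp: mem_coding_domain)
    have "rotation \<alpha> z t \<in> P a \<longleftrightarrow> rotation \<alpha> z t \<in> induced_map \<alpha> B \<phi> P' a"
      by (intro agree rotation_coding_domain P(2) allI impI far) (simp_all add: c(2))
    then have "?\<Phi>p z = a"
      using a coding_induced_map[OF disj(2) t', of B \<phi>] coding_eqI[OF disjoint_induced_map[OF disj(2)]]
      by metis
    moreover have "q z = a" using P(3) coding_eqI[OF disj(1) a] by simp
    ultimately show False using that by simp
  qed
  have card: "card {z \<in> {- int N..<int N}. q z \<noteq> ?\<Phi>p z} \<le> (2 * r + 1) * (2 * N div n + 1)" for N
  proof -
    have "card {z \<in> {- int N..<int N}. q z \<noteq> ?\<Phi>p z} \<le> card (\<Union>j\<in>{- int r..int r}. W N j)"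
    proof (rule card_mono)
      show "finite (\<Union>j\<in>{- int r..int r}. W N j)"
        by (rule finite_subset[of _ "{- int N..<int N}"]) (auto simp: W_def)
      show "{z \<in> {- int N..<int N}. q z \<noteq> ?\<Phi>p z} \<subseteq> (\<Union>j\<in>{- int r..int r}. W N j)"
        using mismatch by (auto simp: W_def)
    qed
    also have "\<dots> \<le> (\<Sum>j\<in>{- int r..int r}. card (W N j))" by (rule card_UN_le) simp
    also have "\<dots> \<le> (\<Sum>j\<in>{- int r..int r}. 2 * N div n + 1)"
    proof (rule sum_mono)
      fix j
      show "card (W N j) \<le> 2 * N div n + 1"
      proof (rule card_separated_le[OF \<open>0 < n\<close>])
        show "i = i'" if "i \<in> W N j" "i' \<in> W N j" "\<bar>i - i'\<bar> < int n" for i i'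
          using sep[of "j + i" t "j + i'"] that by (auto simp: W_def)
      qed (auto simp: W_def)
    qed
    also have "\<dots> = (2 * r + 1) * (2 * N div n + 1)" by (simp add: nat_add_distrib nat_mult_distrib)
    finally show ?thesis .
  qed
  have "besicovitch_dist q ?\<Phi>p \<le> ?K / n"
  proof (rule besicovitch_dist_le)
    show "\<forall>\<^sub>F N in sequentially. card {z \<in> {- int N..<int N}. q z \<noteq> ?\<Phi>p z} / (2 * real N) \<le> ?K / n"
      using eventually_ge_at_top[of n]
    proof eventually_elim
      case (elim N)
      \<comment> \<open>The additive \<open>1\<close> from the partial block is absorbed by a factor \<open>2\<close>, as \<open>N \<ge> n\<close>.\<close>
      have "real (2 * N div n) \<le> real (2 * N) / real n" by (rule of_nat_div_le_of_nat)
      moreover have "1 \<le> real (2 * N) / real n" using elim \<open>0 < n\<close> by simp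
      ultimately have "real (2 * N div n) + 1 \<le> 2 * (real (2 * N) / real n)" by linarith
      then have "(2 * real r + 1) * (real (2 * N div n) + 1) \<le> (2 * real r + 1) * (2 * (real (2 * N) / real n))"
        by (intro mult_left_mono) auto
      moreover have "real (card {z \<in> {- int N..<int N}. q z \<noteq> ?\<Phi>p z}) \<le> (2 * real r + 1) * (real (2 * N div n) + 1)"
        using of_nat_mono[OF card[of N], where ?'a = real] by (simp add: algebra_simps)
      ultimately have "real (card {z \<in> {- int N..<int N}. q z \<noteq> ?\<Phi>p z}) \<le> ?K / n * (2 * real N)"
        by (simp add: algebra_simps)
      then show ?case using elim \<open>0 < n\<close> by (simp add: pos_divide_le_eq)
    qed
  qed simp
  also have "\<dots> < \<epsilon>" using n assms(4) \<open>0 < n\<close> by (simp add: field_simps)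
  finally show ?thesis using quasisturmian_intro[OF Po t'] by blast
qed

text \<open>Choose an open partition in which every point of some nonempty open \<open>V\<close> spells an orphan word. The
  induced image of any partition must disagree with it at one of the \<open>2 m + 1\<close> positions of this word,
  for every point of \<open>V\<close>. So the distance is at least a fixed fraction of the measure of \<open>V\<close>.\<close>

lemma not_surj_imp_not_dense_partitions:
  fixes \<phi> :: "(int \<Rightarrow> 'a::finite) \<Rightarrow> 'a"
  assumes "finite B" "\<not> surj (cellular_automaton B \<phi>)"
  shows "\<not> dense_in partition_dist (induced_map \<alpha> B \<phi> ` open_partitions) open_partitions"
proof
  assume dense: "dense_in partition_dist (induced_map \<alpha> B \<phi> ` open_partitions) open_partitions"
  obtain y :: "int \<Rightarrow> 'a" and m where
    ym: "\<And>p x. \<exists>z. \<bar>z\<bar> \<le> int m \<and> cellular_automaton B \<phi> p (z + x) \<noteq> y z"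
    using orphan_word[OF assms] by metis
  obtain P :: "'a \<Rightarrow> 'k torus set" and V where P: "P \<in> open_partitions" "open V" "V \<noteq> {}"
    "\<And>t z. t \<in> V \<Longrightarrow> \<bar>z\<bar> \<le> int m \<Longrightarrow> rotation \<alpha> z t \<in> P (y z)"
    using open_partition_prescribed_word[of m y] by blast
  have "measure torus_measure V \<noteq> 0"
  proof
    assume "measure torus_measure V = 0"
    then have "AE t in torus_measure. t \<notin> V"
      using P(2) by (intro AE_not_in) (auto simp: null_sets_def torus.emeasure_eq_measure)
    then show False using AE_witness_in_open[OF P(2,3)] by blast
  qed
  then have "0 < measure torus_measure V" by (simp add: zero_less_measure_iff)
  then have "\<exists>Q\<in>induced_map \<alpha> B \<phi> ` open_partitions.
      partition_dist P Q < measure torus_measure V / (2 * real m + 1)"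
    using dense P(1) unfolding dense_in_def by simp
  then obtain P' where P': "P' \<in> open_partitions"
    and near: "partition_dist P (induced_map \<alpha> B \<phi> P') < measure torus_measure V / (2 * real m + 1)"
    by blast
  let ?Q = "induced_map \<alpha> B \<phi> P'"
  have disj: "disjoint_family P'" using P' by (simp add: open_partitions_iff)
  let ?D = "\<lambda>a. sym_diff (P a) (?Q a)"
  have D: "?D a \<in> sets torus_measure" for a
    using P(1) induced_map_open[OF assms(1) P', of \<phi>]
    by (intro sets.Un sets.Diff open_sets_torus) (simp_all add: open_partitions_iff)
  have "V \<subseteq> (\<Union>z\<in>{- int m..int m}. {t. rotation \<alpha> z t \<in> ?D (y z)})"
  proof
    fix t assume t: "t \<in> V"
    obtain z where z: "\<bar>z\<bar> \<le> int m" "cellular_automaton B \<phi> (coding \<alpha> P' t) z \<noteq> y z"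
      using ym[of "coding \<alpha> P' t" 0] by auto
    have "rotation \<alpha> z t \<notin> ?Q (y z)"
      using z(2) by (auto simp: induced_map_iff_coding[OF disj] coding_rotation
          cellular_automaton_def add.commute cong: restrict_cong)
    then show "t \<in> (\<Union>z\<in>{- int m..int m}. {t. rotation \<alpha> z t \<in> ?D (y z)})"
      using P(4)[OF t z(1)] z(1) by (intro UN_I[of z]) auto
  qed
  then have "measure torus_measure V \<le> measure torus_measure (\<Union>z\<in>{- int m..int m}. {t. rotation \<alpha> z t \<in> ?D (y z)})"
    using sets_rotation[OF D] by (intro torus.finite_measure_mono sets.finite_UN) auto
  also have "\<dots> \<le> (\<Sum>z\<in>{- int m..int m}. measure torus_measure {t. rotation \<alpha> z t \<in> ?D (y z)})"
    using sets_rotation[OF D] by (intro torus.finite_measure_subadditive_finite) auto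
  also have "\<dots> \<le> (\<Sum>z\<in>{- int m..int m}. partition_dist P ?Q)"
  proof (rule sum_mono)
    fix z
    have "measure torus_measure {t. rotation \<alpha> z t \<in> ?D (y z)} = measure torus_measure (?D (y z))"
      by (rule measure_rotation[OF D])
    also have "\<dots> \<le> partition_dist P ?Q"
      unfolding partition_dist_def
      by (rule member_le_sum[where f = "\<lambda>a. measure torus_measure (?D a)"]) auto
    finally show "measure torus_measure {t. rotation \<alpha> z t \<in> ?D (y z)} \<le> partition_dist P ?Q" .
  qed
  also have "\<dots> = (2 * real m + 1) * partition_dist P ?Q" by simp
  finally show False using near by (simp add: field_simps)
qed

text \<open>In a sequence coded by such a partition the orphan word recurs with bounded gaps, and every image of
  the automaton disagrees with each occurrence. Hence the disagreements have positive lower density.\<close>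

lemma not_surj_imp_not_besicovitch_dense:
  fixes \<phi> :: "(int \<Rightarrow> 'a::finite) \<Rightarrow> 'a"
  assumes "finite B" "\<not> surj (cellular_automaton B \<phi>)"
  shows "\<not> dense_in besicovitch_dist (cellular_automaton B \<phi> ` quasisturmian \<alpha>) (quasisturmian \<alpha>)"
proof
  assume dense: "dense_in besicovitch_dist (cellular_automaton B \<phi> ` quasisturmian \<alpha>) (quasisturmian \<alpha>)"
  obtain y :: "int \<Rightarrow> 'a" and m where
    ym: "\<And>p x. \<exists>z. \<bar>z\<bar> \<le> int m \<and> cellular_automaton B \<phi> p (z + x) \<noteq> y z"
    using orphan_word[OF assms] by metis
  obtain P :: "'a \<Rightarrow> 'k torus set" and V where P: "P \<in> open_partitions" "open V" "V \<noteq> {}"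
    "\<And>t z. t \<in> V \<Longrightarrow> \<bar>z\<bar> \<le> int m \<Longrightarrow> rotation \<alpha> z t \<in> P (y z)"
    using open_partition_prescribed_word[of m y] by blast
  have Pm: "P \<in> measurable_partitions" using P(1) by (simp add: open_partitions_def)
  have disj: "disjoint_family P" using P(1) by (simp add: open_partitions_iff)
  obtain t where t: "t \<in> coding_domain \<alpha> P"
    using AE_witness_in_open[OF P(2,3) AE_coding_domain[OF Pm]] by blast
  let ?q = "coding \<alpha> P t"
  obtain L :: nat where L: "\<And>t x. \<exists>z\<in>{x..<x + int L}. rotation \<alpha> z t \<in> V"
    using visits_syndetic[OF P(2,3)] by metis
  \<comment> \<open>Long enough for a window to contain a visit to \<open>V\<close> together with the whole word around it.\<close>
  define M where "M = L + 2 * m + 1"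
  have "0 < M" by (simp add: M_def)
  have "1 / (2 * real M) \<le> besicovitch_dist ?q (cellular_automaton B \<phi> p)" for p
  proof (rule besicovitch_dist_ge)
    let ?S = "{z. ?q z \<noteq> cellular_automaton B \<phi> p z}"
    have syn: "\<exists>z\<in>{x..<x + int M}. z \<in> ?S" for x
    proof -
      obtain v where v: "v \<in> {x + int m..<x + int m + int L}" "rotation \<alpha> v t \<in> V" using L by blast
      obtain z where z: "\<bar>z\<bar> \<le> int m" "cellular_automaton B \<phi> p (z + v) \<noteq> y z" using ym by blast
      have "?q (z + v) = y z"
        using coding_eqI[OF disj, of \<alpha> "z + v" t "y z"] P(4)[OF v(2) z(1)] by simp
      with z(2) have "z + v \<in> ?S" by simp
      then show ?thesis using v(1) z(1) by (intro bexI[of _ "z + v"]) (auto simp: M_def)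
    qed
    show "\<forall>\<^sub>F N in sequentially. 1 / (2 * real M)
        \<le> card {z \<in> {- int N..<int N}. ?q z \<noteq> cellular_automaton B \<phi> p z} / (2 * real N)"
      using eventually_ge_at_top[of M]
    proof eventually_elim
      case (elim N)
      have "2 * N < (2 * N div M + 1) * M"
        using dividend_less_div_times[OF \<open>0 < M\<close>, of "2 * N"] by (simp add: algebra_simps)
      from of_nat_less_iff[where ?'a = real, THEN iffD2, OF this]
      have "real (2 * N) / real M - 1 \<le> real (2 * N div M)"
        using \<open>0 < M\<close> by (simp add: pos_divide_le_eq algebra_simps)
      also have "\<dots> \<le> card {z \<in> {- int N..<int N}. ?q z \<noteq> cellular_automaton B \<phi> p z}"
        using card_syndetic_ge[OF \<open>0 < M\<close> syn, of N] by simp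
      finally have "real (2 * N) / real M - 1 \<le> card {z \<in> {- int N..<int N}. ?q z \<noteq> cellular_automaton B \<phi> p z}" .
      moreover have "1 \<le> real N / real M" using elim \<open>0 < M\<close> by simp
      ultimately have "1 / (2 * real M) * (2 * real N) \<le> card {z \<in> {- int N..<int N}. ?q z \<noteq> cellular_automaton B \<phi> p z}"
        by simp
      then show ?case using elim \<open>0 < M\<close> by (subst pos_le_divide_eq) auto
    qed
  qed
  moreover have "\<exists>s\<in>cellular_automaton B \<phi> ` quasisturmian \<alpha>. besicovitch_dist ?q s < 1 / (2 * real M)"
    using dense quasisturmian_intro[OF P(1) t] \<open>0 < M\<close> unfolding dense_in_def by simp
  ultimately show False by (auto simp: not_less[symmetric])
qed

end

theorem theorem8p2:
  fixes \<alpha> :: "'k::finite torus"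
    and B :: "int set"
    and \<phi> :: "(int \<Rightarrow> 'a::finite) \<Rightarrow> 'a"
    and \<Phi> :: "(int \<Rightarrow> 'a) \<Rightarrow> (int \<Rightarrow> 'a)"
  assumes "inj (\<lambda>z. torus_zmult z \<alpha>)"
    and "closure (range (\<lambda>z. torus_zmult z \<alpha>)) = UNIV"
    and "finite B"
    and "\<Phi> = cellular_automaton B \<phi>"
  shows "(surj \<Phi> \<longleftrightarrow>
            dense_in partition_dist (induced_map \<alpha> B \<phi> ` measurable_partitions) measurable_partitions \<and>
            dense_in partition_dist (induced_map \<alpha> B \<phi> ` open_partitions) open_partitions) \<and>
         (surj \<Phi> \<longleftrightarrow> dense_in besicovitch_dist (\<Phi> ` quasisturmian \<alpha>) (quasisturmian \<alpha>)) \<and>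
         (surj \<Phi> \<longleftrightarrow> dense_in cantor_dist (\<Phi> ` quasisturmian \<alpha>) (quasisturmian \<alpha>))"
proof -
  interpret minimal_rotation \<alpha> using assms(1,2) by unfold_locales
  note fin = assms(3) and \<Phi> = assms(4)
  have partitions: "surj \<Phi> \<longleftrightarrow>
      dense_in partition_dist (induced_map \<alpha> B \<phi> ` measurable_partitions) measurable_partitions \<and>
      dense_in partition_dist (induced_map \<alpha> B \<phi> ` open_partitions) open_partitions"
    (is "_ \<longleftrightarrow> ?M \<and> ?O")
  proof
    assume surj: "surj \<Phi>"
    note approx = approximate_preimage_partition_dist[OF surj[unfolded \<Phi>] fin]
    have ?M
      unfolding dense_in_def
    proof (intro conjI ballI allI impI image_subsetI induced_map_measurable[OF fin])
      fix P :: "'a \<Rightarrow> 'k torus set" and \<epsilon> :: real assume "P \<in> measurable_partitions" "0 < \<epsilon>"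
      then show "\<exists>Q\<in>induced_map \<alpha> B \<phi> ` measurable_partitions. partition_dist P Q < \<epsilon>"
        using approx[of P \<epsilon>] by blast
    qed
    moreover have ?O
      unfolding dense_in_def
    proof (intro conjI ballI allI impI image_subsetI induced_map_open[OF fin])
      fix P :: "'a \<Rightarrow> 'k torus set" and \<epsilon> :: real assume P: "P \<in> open_partitions" "0 < \<epsilon>"
      then have "P \<in> measurable_partitions" by (simp add: open_partitions_def)
      with P show "\<exists>Q\<in>induced_map \<alpha> B \<phi> ` open_partitions. partition_dist P Q < \<epsilon>"
        using approx[of P \<epsilon>] by blast
    qed
    ultimately show "?M \<and> ?O" ..
  next
    assume "?M \<and> ?O"
    then show "surj \<Phi>" using not_surj_imp_not_dense_partitions[OF fin, of \<phi>] \<Phi> by auto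
  qed
  have besicovitch: "surj \<Phi> \<longleftrightarrow> dense_in besicovitch_dist (\<Phi> ` quasisturmian \<alpha>) (quasisturmian \<alpha>)"
    (is "_ \<longleftrightarrow> ?D")
  proof
    assume surj: "surj \<Phi>"
    show ?D
      unfolding dense_in_def
    proof (intro conjI ballI allI impI)
      show "\<Phi> ` quasisturmian \<alpha> \<subseteq> quasisturmian \<alpha>"
        unfolding \<Phi> by (rule cellular_automaton_quasisturmian[OF fin])
      fix q :: "int \<Rightarrow> 'a" and \<epsilon> :: real assume "q \<in> quasisturmian \<alpha>" "0 < \<epsilon>"
      then show "\<exists>s\<in>\<Phi> ` quasisturmian \<alpha>. besicovitch_dist q s < \<epsilon>"
        using approximate_preimage_besicovitch[OF surj[unfolded \<Phi>] fin, of q \<epsilon>] \<Phi> by blast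
    qed
  next
    assume ?D
    then show "surj \<Phi>" using not_surj_imp_not_besicovitch_dense[OF fin, of \<phi>] \<Phi> by auto
  qed
  have cantor: "surj \<Phi> \<longleftrightarrow> dense_in cantor_dist (\<Phi> ` quasisturmian \<alpha>) (quasisturmian \<alpha>)"
    unfolding \<Phi> by (rule surj_iff_cantor_dense[OF fin])
  show ?thesis using partitions besicovitch cantor by (intro conjI)
qed

end
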